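(* Let $S$ be a scheme, $M$ a commutative monoid, and $X$ an $S$-algebraic space endowed with an action of $A(M)_S$. Assume that $X$ is separated over $S$ and let $N\subset N'$ be two submonoids of $M$. Then the canonical map of functors $X^N\to X^{N'}$ is a monomorphism, i.e. for any scheme $T$ over $S$ there is a canonical inclusion $X^N(T)\subset X^{N'}(T)$.
   Context: All monoids and rings are commutative. For a monoid $N$, $\mathbb{Z}[N]=\bigoplus_{n\in N}\mathbb{Z}X^n$ with $X^nX^{n'}=X^{n+n'}$, $A(N)=\mathrm{Spec}(\mathbb{Z}[N])$ is a monoid scheme (comultiplication $X^n\mapsto X^n\otimes X^n$, counit $X^n\mapsto 1$), and $A(N)_S$ is its base change to $S$. If $N\subset M$ is a submonoid, $A(M)_S$ acts on $A(N)_S$ via $X^n\mapsto X^n\otimes X^n$. The attractor $X^N$ is the functor on $S$-schemes sending $T$ to the set $\mathrm{Hom}_T^{A(M)_T}(A(N)_T,X_T)$ of $A(M)_T$-equivariant $T$-morphisms $A(N)_T\to X_T=X\times_S T$, with functoriality by base change. For submonoids $N\subset N'$ of $M$, the inclusion $\mathbb{Z}[N]\subset\mathbb{Z}[N']$ gives an equivariant morphism $A(N')_T\to A(N)_T$, and $X^N\to X^{N'}$ is precomposition with it. *)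

theory Defs
  imports "HOL-Algebra.IntRing" "HOL-Algebra.QuotRing"
begin

text \<open>
  Algebraic geometry is set up through functors of points.  The rings with carrier in a type
  \<open>'u\<close> (which the theorem assumes to be infinite) play the role of a universe: up to isomorphism
  they are the commutative rings of cardinality at most that of \<open>'u\<close>, a class closed under
  quotients, localizations, tensor products, algebras of finite type and monoid algebras over
  monoids with elements in \<open>'u\<close>.  A scheme or an algebraic space is a set-valued functor on these
  rings, satisfying a sheaf condition and covered by affines.  A sheaf on all schemes over \<open>S\<close> is
  determined by its values on affine schemes; and a functor over the base \<open>S\<close> is a functor together
  with a morphism to \<open>S\<close>.  Every given scheme or algebraic space is covered by affines of bounded
  size, so it is described in this way once \<open>'u\<close> is taken large enough.
\<close>


section \<open>Functors on commutative rings\<close>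

text \<open>Ring homomorphisms are normalized to be \<open>undefined\<close> outside the carrier of their domain, so
  that equality of functions is equality of homomorphisms.\<close>

definition Hom :: "('a, 'c) ring_scheme \<Rightarrow> ('b, 'd) ring_scheme \<Rightarrow> ('a \<Rightarrow> 'b) set" where
  "Hom A B = ring_hom A B \<inter> extensional (carrier A)"

record ('u, 'x) rfun =
  obj :: "'u ring \<Rightarrow> 'x set"
  arr :: "'u ring \<Rightarrow> 'u ring \<Rightarrow> ('u \<Rightarrow> 'u) \<Rightarrow> 'x \<Rightarrow> 'x"

definition ring_functor :: "('u, 'x) rfun \<Rightarrow> bool" where
  "ring_functor F \<longleftrightarrow>
    (\<forall>A B h. cring A \<and> cring B \<and> h \<in> Hom A B \<longrightarrow> arr F A B h \<in> obj F A \<rightarrow> obj F B) \<and>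
    (\<forall>A x. cring A \<and> x \<in> obj F A \<longrightarrow> arr F A A (\<lambda>a\<in>carrier A. a) x = x) \<and>
    (\<forall>A B C h k x. cring A \<and> cring B \<and> cring C \<and> h \<in> Hom A B \<and> k \<in> Hom B C \<and> x \<in> obj F A \<longrightarrow>
       arr F A C (compose (carrier A) k h) x = arr F B C k (arr F A B h x))"

text \<open>Natural transformations, normalized in the same way as homomorphisms.\<close>

definition mor :: "('u, 'x) rfun \<Rightarrow> ('u, 'y) rfun \<Rightarrow> ('u ring \<Rightarrow> 'x \<Rightarrow> 'y) set" where
  "mor F G = {\<alpha> \<in> (\<Pi>\<^sub>E A\<in>Collect cring. obj F A \<rightarrow>\<^sub>E obj G A).
     \<forall>A B h x. cring A \<and> cring B \<and> h \<in> Hom A B \<and> x \<in> obj F A \<longrightarrow>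
       \<alpha> B (arr F A B h x) = arr G A B h (\<alpha> A x)}"

definition mcomp ::
  "('u, 'x) rfun \<Rightarrow> ('u ring \<Rightarrow> 'y \<Rightarrow> 'z) \<Rightarrow> ('u ring \<Rightarrow> 'x \<Rightarrow> 'y) \<Rightarrow> 'u ring \<Rightarrow> 'x \<Rightarrow> 'z" where
  "mcomp F \<beta> \<alpha> = (\<lambda>A\<in>Collect cring. compose (obj F A) (\<beta> A) (\<alpha> A))"

definition Spec :: "('a, 'c) ring_scheme \<Rightarrow> ('u, 'a \<Rightarrow> 'u) rfun" where
  "Spec A = \<lparr>obj = (\<lambda>R. Hom A R), arr = (\<lambda>R R' h g. compose (carrier A) h g)\<rparr>"

text \<open>The morphism \<open>Spec A \<rightarrow> F\<close> corresponding to \<open>x \<in> F(A)\<close> under the Yoneda lemma.\<close>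

definition yoneda :: "('u, 'x) rfun \<Rightarrow> 'u ring \<Rightarrow> 'x \<Rightarrow> 'u ring \<Rightarrow> ('u \<Rightarrow> 'u) \<Rightarrow> 'x" where
  "yoneda F A x = (\<lambda>R\<in>Collect cring. \<lambda>h\<in>Hom A R. arr F A R h x)"

definition pullback ::
  "('u, 'x) rfun \<Rightarrow> ('u, 'y) rfun \<Rightarrow> ('u ring \<Rightarrow> 'x \<Rightarrow> 'z) \<Rightarrow> ('u ring \<Rightarrow> 'y \<Rightarrow> 'z) \<Rightarrow> ('u, 'x \<times> 'y) rfun" where
  "pullback F G \<alpha> \<beta> =
    \<lparr>obj = (\<lambda>A. {(x, y). x \<in> obj F A \<and> y \<in> obj G A \<and> \<alpha> A x = \<beta> A y}),
     arr = (\<lambda>A B h. map_prod (arr F A B h) (arr G A B h))\<rparr>"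

definition fprod :: "('u, 'x) rfun \<Rightarrow> ('u, 'y) rfun \<Rightarrow> ('u, 'x \<times> 'y) rfun" where
  "fprod F G =
    \<lparr>obj = (\<lambda>A. obj F A \<times> obj G A), arr = (\<lambda>A B h. map_prod (arr F A B h) (arr G A B h))\<rparr>"

definition proj1 :: "('u, 'x \<times> 'y) rfun \<Rightarrow> 'u ring \<Rightarrow> 'x \<times> 'y \<Rightarrow> 'x" where
  "proj1 P = (\<lambda>A\<in>Collect cring. restrict fst (obj P A))"

definition proj2 :: "('u, 'x \<times> 'y) rfun \<Rightarrow> 'u ring \<Rightarrow> 'x \<times> 'y \<Rightarrow> 'y" where
  "proj2 P = (\<lambda>A\<in>Collect cring. restrict snd (obj P A))"

definition diagonal :: "('u, 'x) rfun \<Rightarrow> 'u ring \<Rightarrow> 'x \<Rightarrow> 'x \<times> 'x" where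
  "diagonal F = (\<lambda>A\<in>Collect cring. \<lambda>x\<in>obj F A. (x, x))"


section \<open>Monoid algebras\<close>

text \<open>\<open>A[N]\<close> for a submonoid \<open>N\<close> of \<open>M\<close>: finitely supported functions on \<open>M\<close> vanishing outside
  \<open>N\<close>, so that \<open>A[N] \<subseteq> A[N']\<close> holds literally when \<open>N \<subseteq> N'\<close>.\<close>

definition monoid_algebra ::
  "('a, 'c) ring_scheme \<Rightarrow> ('m, 'e) monoid_scheme \<Rightarrow> 'm set \<Rightarrow> ('m \<Rightarrow> 'a) ring" where
  "monoid_algebra A M N =
    \<lparr>carrier = {f. (\<forall>n. f n \<in> carrier A) \<and> finite {n. f n \<noteq> \<zero>\<^bsub>A\<^esub>} \<and> {n. f n \<noteq> \<zero>\<^bsub>A\<^esub>} \<subseteq> N},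
     mult = (\<lambda>f g n.
       finsum A (\<lambda>(k, l). f k \<otimes>\<^bsub>A\<^esub> g l)
         {(k, l). f k \<noteq> \<zero>\<^bsub>A\<^esub> \<and> g l \<noteq> \<zero>\<^bsub>A\<^esub> \<and> k \<otimes>\<^bsub>M\<^esub> l = n}),
     one = (\<lambda>n. if n = \<one>\<^bsub>M\<^esub> then \<one>\<^bsub>A\<^esub> else \<zero>\<^bsub>A\<^esub>),
     zero = (\<lambda>n. \<zero>\<^bsub>A\<^esub>),
     add = (\<lambda>f g n. f n \<oplus>\<^bsub>A\<^esub> g n)\<rparr>"

definition Xpow :: "'m \<Rightarrow> 'm \<Rightarrow> int" where
  "Xpow n = (\<lambda>k. if k = n then 1 else 0)"

abbreviation ZZ :: "('m, 'e) monoid_scheme \<Rightarrow> 'm set \<Rightarrow> ('m \<Rightarrow> int) ring" where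
  "ZZ M N \<equiv> monoid_algebra \<Z> M N"

text \<open>The additive monoid \<open>\<nat>\<^sup>n\<close>, so that \<open>poly_ring A n\<close> is \<open>A[x\<^sub>1, \<dots>, x\<^sub>n]\<close>.\<close>

definition exponents :: "nat \<Rightarrow> (nat \<Rightarrow> nat) monoid" where
  "exponents n = \<lparr>carrier = {e. \<forall>i\<ge>n. e i = 0}, mult = (\<lambda>e e' i. e i + e' i), one = (\<lambda>i. 0)\<rparr>"

definition poly_ring :: "('a, 'c) ring_scheme \<Rightarrow> nat \<Rightarrow> ((nat \<Rightarrow> nat) \<Rightarrow> 'a) ring" where
  "poly_ring A n = monoid_algebra A (exponents n) (carrier (exponents n))"

definition poly_const :: "('a, 'c) ring_scheme \<Rightarrow> 'a \<Rightarrow> (nat \<Rightarrow> nat) \<Rightarrow> 'a" where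
  "poly_const A a = (\<lambda>e. if e = (\<lambda>i. 0) then a else \<zero>\<^bsub>A\<^esub>)"


section \<open>Localizations and etale ring maps\<close>

text \<open>\<open>h : A \<rightarrow> B\<close> identifies \<open>B\<close> with \<open>A[1/f]\<close>.\<close>

definition is_localization :: "'u ring \<Rightarrow> 'u \<Rightarrow> 'u ring \<Rightarrow> ('u \<Rightarrow> 'u) \<Rightarrow> bool" where
  "is_localization A f B h \<longleftrightarrow> h \<in> Hom A B \<and> f \<in> carrier A \<and> h f \<in> Units B \<and>
    (\<forall>b\<in>carrier B. \<exists>a\<in>carrier A. \<exists>n::nat. b \<otimes>\<^bsub>B\<^esub> (h f [^]\<^bsub>B\<^esub> n) = h a) \<and>
    (\<forall>a\<in>carrier A. h a = \<zero>\<^bsub>B\<^esub> \<longrightarrow> (\<exists>n::nat. (f [^]\<^bsub>A\<^esub> n) \<otimes>\<^bsub>A\<^esub> a = \<zero>\<^bsub>A\<^esub>))"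

definition finitely_presented :: "'u ring \<Rightarrow> 'u ring \<Rightarrow> ('u \<Rightarrow> 'u) \<Rightarrow> bool" where
  "finitely_presented A B h \<longleftrightarrow>
    (\<exists>n. \<exists>\<phi>\<in>Hom (poly_ring A n) B.
       \<phi> ` carrier (poly_ring A n) = carrier B \<and>
       (\<forall>a\<in>carrier A. \<phi> (poly_const A a) = h a) \<and>
       (\<exists>E. finite E \<and> E \<subseteq> carrier (poly_ring A n) \<and>
          a_kernel (poly_ring A n) B \<phi> = genideal (poly_ring A n) E))"

definition formally_etale :: "'u ring \<Rightarrow> 'u ring \<Rightarrow> ('u \<Rightarrow> 'u) \<Rightarrow> bool" where
  "formally_etale A B h \<longleftrightarrow>
    (\<forall>(R::'u ring) I k m. cring R \<and> ideal I R \<and> (\<forall>x\<in>I. \<forall>y\<in>I. x \<otimes>\<^bsub>R\<^esub> y = \<zero>\<^bsub>R\<^esub>) \<and>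
       k \<in> Hom A R \<and> m \<in> Hom B (R Quot I) \<and> (\<forall>a\<in>carrier A. m (h a) = I +>\<^bsub>R\<^esub> k a) \<longrightarrow>
       (\<exists>!l. l \<in> Hom B R \<and> (\<forall>a\<in>carrier A. l (h a) = k a) \<and> (\<forall>b\<in>carrier B. I +>\<^bsub>R\<^esub> l b = m b)))"

definition etale_hom :: "'u ring \<Rightarrow> 'u ring \<Rightarrow> ('u \<Rightarrow> 'u) \<Rightarrow> bool" where
  "etale_hom A B h \<longleftrightarrow> h \<in> Hom A B \<and> finitely_presented A B h \<and> formally_etale A B h"


section \<open>Sheaves\<close>

definition zariski_covering ::
  "'u ring \<Rightarrow> nat \<Rightarrow> (nat \<Rightarrow> 'u ring) \<Rightarrow> (nat \<Rightarrow> 'u \<Rightarrow> 'u) \<Rightarrow> bool" where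
  "zariski_covering A n B h \<longleftrightarrow>
    (\<forall>i<n. cring (B i)) \<and>
    (\<exists>f. (\<forall>i<n. is_localization A (f i) (B i) (h i)) \<and> genideal A (f ` {..<n}) = carrier A)"

definition etale_covering ::
  "'u ring \<Rightarrow> nat \<Rightarrow> (nat \<Rightarrow> 'u ring) \<Rightarrow> (nat \<Rightarrow> 'u \<Rightarrow> 'u) \<Rightarrow> bool" where
  "etale_covering A n B h \<longleftrightarrow>
    (\<forall>i<n. cring (B i) \<and> etale_hom A (B i) (h i)) \<and>
    (\<forall>P. primeideal P A \<longrightarrow>
       (\<exists>i<n. \<exists>Q. primeideal Q (B i) \<and> P = {a \<in> carrier A. h i a \<in> Q}))"

text \<open>Compatible families are required to agree after every pair of maps \<open>k, l\<close> out of \<open>B i\<close> and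
  \<open>B j\<close> that coincide on \<open>A\<close>; this is the same as agreement in \<open>B i \<otimes>\<^sub>A B j\<close>.\<close>

definition compatible_family ::
  "('u, 'x) rfun \<Rightarrow> 'u ring \<Rightarrow> nat \<Rightarrow> (nat \<Rightarrow> 'u ring) \<Rightarrow> (nat \<Rightarrow> 'u \<Rightarrow> 'u) \<Rightarrow> (nat \<Rightarrow> 'x) \<Rightarrow> bool" where
  "compatible_family F A n B h x \<longleftrightarrow>
    (\<forall>i<n. x i \<in> obj F (B i)) \<and>
    (\<forall>i<n. \<forall>j<n. \<forall>C k l. cring C \<and> k \<in> Hom (B i) C \<and> l \<in> Hom (B j) C \<and>
       compose (carrier A) k (h i) = compose (carrier A) l (h j) \<longrightarrow>
       arr F (B i) C k (x i) = arr F (B j) C l (x j))"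

definition sheaf_condition ::
  "('u, 'x) rfun \<Rightarrow> 'u ring \<Rightarrow> nat \<Rightarrow> (nat \<Rightarrow> 'u ring) \<Rightarrow> (nat \<Rightarrow> 'u \<Rightarrow> 'u) \<Rightarrow> bool" where
  "sheaf_condition F A n B h \<longleftrightarrow>
    (\<forall>x. compatible_family F A n B h x \<longrightarrow>
       (\<exists>!y. y \<in> obj F A \<and> (\<forall>i<n. arr F A (B i) (h i) y = x i)))"

definition zariski_sheaf :: "('u, 'x) rfun \<Rightarrow> bool" where
  "zariski_sheaf F \<longleftrightarrow> ring_functor F \<and>
    (\<forall>A n B h. cring A \<and> zariski_covering A n B h \<longrightarrow> sheaf_condition F A n B h)"

definition etale_sheaf :: "('u, 'x) rfun \<Rightarrow> bool" where
  "etale_sheaf F \<longleftrightarrow> ring_functor F \<and>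
    (\<forall>A n B h. cring A \<and> etale_covering A n B h \<longrightarrow> sheaf_condition F A n B h)"


section \<open>Schemes\<close>

text \<open>A morphism is an open (closed) immersion if it is a monomorphism and the pullback of its image
  along every \<open>Spec A \<rightarrow> G\<close> is the open subfunctor \<open>D(I)\<close> (the closed subfunctor \<open>V(I)\<close>) of \<open>Spec A\<close>
  for some ideal \<open>I\<close>.  A \<open>B\<close>-valued point \<open>h\<close> of \<open>Spec A\<close> lies in \<open>D(I)\<close> iff \<open>h(I)\<close> generates the
  unit ideal, and in \<open>V(I)\<close> iff \<open>h(I) = 0\<close>.\<close>

definition open_immersion ::
  "('u, 'x) rfun \<Rightarrow> ('u, 'y) rfun \<Rightarrow> ('u ring \<Rightarrow> 'x \<Rightarrow> 'y) \<Rightarrow> bool" where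
  "open_immersion F G \<alpha> \<longleftrightarrow> \<alpha> \<in> mor F G \<and>
    (\<forall>A. cring A \<longrightarrow> inj_on (\<alpha> A) (obj F A)) \<and>
    (\<forall>A y. cring A \<and> y \<in> obj G A \<longrightarrow>
       (\<exists>I. ideal I A \<and> (\<forall>B h. cring B \<and> h \<in> Hom A B \<longrightarrow>
          (arr G A B h y \<in> \<alpha> B ` obj F B \<longleftrightarrow> genideal B (h ` I) = carrier B))))"

definition closed_immersion ::
  "('u, 'x) rfun \<Rightarrow> ('u, 'y) rfun \<Rightarrow> ('u ring \<Rightarrow> 'x \<Rightarrow> 'y) \<Rightarrow> bool" where
  "closed_immersion F G \<alpha> \<longleftrightarrow> \<alpha> \<in> mor F G \<and>
    (\<forall>A. cring A \<longrightarrow> inj_on (\<alpha> A) (obj F A)) \<and>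
    (\<forall>A y. cring A \<and> y \<in> obj G A \<longrightarrow>
       (\<exists>I. ideal I A \<and> (\<forall>B h. cring B \<and> h \<in> Hom A B \<longrightarrow>
          (arr G A B h y \<in> \<alpha> B ` obj F B \<longleftrightarrow> h ` I \<subseteq> {\<zero>\<^bsub>B\<^esub>}))))"

definition affine_open :: "('u, 'x) rfun \<Rightarrow> 'u ring \<Rightarrow> 'x \<Rightarrow> bool" where
  "affine_open F A x \<longleftrightarrow> cring A \<and> x \<in> obj F A \<and> open_immersion (Spec A) F (yoneda F A x)"

text \<open>Covering is tested on points with values in fields.\<close>

definition affine_open_cover :: "('u, 'x) rfun \<Rightarrow> ('u ring \<times> 'x) set \<Rightarrow> bool" where
  "affine_open_cover F \<U> \<longleftrightarrow>
    (\<forall>(A, x)\<in>\<U>. affine_open F A x) \<and>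
    (\<forall>K z. field K \<and> z \<in> obj F K \<longrightarrow> (\<exists>(A, x)\<in>\<U>. \<exists>h\<in>Hom A K. arr F A K h x = z))"

definition is_scheme :: "('u, 'x) rfun \<Rightarrow> bool" where
  "is_scheme F \<longleftrightarrow> zariski_sheaf F \<and> (\<exists>\<U>. affine_open_cover F \<U>)"

definition etale_scheme_mor ::
  "('u, 'x) rfun \<Rightarrow> ('u, 'y) rfun \<Rightarrow> ('u ring \<Rightarrow> 'x \<Rightarrow> 'y) \<Rightarrow> bool" where
  "etale_scheme_mor F G \<alpha> \<longleftrightarrow> \<alpha> \<in> mor F G \<and>
    (\<exists>\<U>. affine_open_cover F \<U> \<and>
       (\<forall>(B, x)\<in>\<U>. \<exists>A y h. affine_open G A y \<and> etale_hom A B h \<and> \<alpha> B x = arr G A B h y))"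

definition surjective_scheme_mor ::
  "('u, 'x) rfun \<Rightarrow> ('u, 'y) rfun \<Rightarrow> ('u ring \<Rightarrow> 'x \<Rightarrow> 'y) \<Rightarrow> bool" where
  "surjective_scheme_mor F G \<alpha> \<longleftrightarrow> \<alpha> \<in> mor F G \<and>
    (\<forall>K y. field K \<and> y \<in> obj G K \<longrightarrow>
       (\<exists>L k. field L \<and> k \<in> Hom K L \<and> (\<exists>x\<in>obj F L. \<alpha> L x = arr G K L k y)))"


section \<open>Algebraic spaces\<close>

text \<open>Base change of \<open>\<alpha> : F \<rightarrow> G\<close> along \<open>Spec A \<rightarrow> G\<close>.\<close>

abbreviation affine_base_change ::
  "('u, 'x) rfun \<Rightarrow> ('u, 'y) rfun \<Rightarrow> ('u ring \<Rightarrow> 'x \<Rightarrow> 'y) \<Rightarrow> 'u ring \<Rightarrow> 'y \<Rightarrow> ('u, ('u \<Rightarrow> 'u) \<times> 'x) rfun" where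
  "affine_base_change F G \<alpha> A y \<equiv> pullback (Spec A) F (yoneda G A y) \<alpha>"

definition representable_by_schemes ::
  "('u, 'x) rfun \<Rightarrow> ('u, 'y) rfun \<Rightarrow> ('u ring \<Rightarrow> 'x \<Rightarrow> 'y) \<Rightarrow> bool" where
  "representable_by_schemes F G \<alpha> \<longleftrightarrow> \<alpha> \<in> mor F G \<and>
    (\<forall>A y. cring A \<and> y \<in> obj G A \<longrightarrow> is_scheme (affine_base_change F G \<alpha> A y))"

definition etale_surjective ::
  "('u, 'x) rfun \<Rightarrow> ('u, 'y) rfun \<Rightarrow> ('u ring \<Rightarrow> 'x \<Rightarrow> 'y) \<Rightarrow> bool" where
  "etale_surjective F G \<alpha> \<longleftrightarrow> representable_by_schemes F G \<alpha> \<and>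
    (\<forall>A y. cring A \<and> y \<in> obj G A \<longrightarrow>
       (let W = affine_base_change F G \<alpha> A y in
          etale_scheme_mor W (Spec A) (proj1 W) \<and> surjective_scheme_mor W (Spec A) (proj1 W)))"

text \<open>The type argument is the type in which the atlas \<open>U\<close> takes its values.\<close>

definition algebraic_space_over ::
  "'v itself \<Rightarrow> ('u, 's) rfun \<Rightarrow> ('u, 'x) rfun \<Rightarrow> ('u ring \<Rightarrow> 'x \<Rightarrow> 's) \<Rightarrow> bool" where
  "algebraic_space_over _ S X p \<longleftrightarrow>
    etale_sheaf X \<and> p \<in> mor X S \<and>
    representable_by_schemes X (pullback X X p p) (diagonal X) \<and>
    (\<exists>(U :: ('u, 'v) rfun) \<pi>. is_scheme U \<and> etale_surjective U X \<pi>)"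

definition separated_over ::
  "('u, 's) rfun \<Rightarrow> ('u, 'x) rfun \<Rightarrow> ('u ring \<Rightarrow> 'x \<Rightarrow> 's) \<Rightarrow> bool" where
  "separated_over S X p \<longleftrightarrow> p \<in> mor X S \<and> closed_immersion X (pullback X X p p) (diagonal X)"


section \<open>Diagonalizable monoid schemes and their actions\<close>

text \<open>\<open>A(N)\<^sub>T\<close>, as a functor over \<open>T\<close> via the second projection.\<close>

definition AN ::
  "('m, 'e) monoid_scheme \<Rightarrow> 'm set \<Rightarrow> ('u, 't) rfun \<Rightarrow> ('u, (('m \<Rightarrow> int) \<Rightarrow> 'u) \<times> 't) rfun" where
  "AN M N T = fprod (Spec (ZZ M N)) T"

text \<open>The ring homomorphism \<open>\<int>[N] \<rightarrow> R\<close>, linear over \<open>\<int>\<close>, with \<open>X\<^sup>n \<mapsto> c n\<close>.\<close>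

definition char_hom ::
  "('m, 'e) monoid_scheme \<Rightarrow> 'm set \<Rightarrow> 'u ring \<Rightarrow> ('m \<Rightarrow> 'u) \<Rightarrow> ('m \<Rightarrow> int) \<Rightarrow> 'u" where
  "char_hom M N R c = (\<lambda>f\<in>carrier (ZZ M N). finsum R (\<lambda>n. [f n] \<cdot>\<^bsub>R\<^esub> c n) {n. f n \<noteq> 0})"

text \<open>On \<open>R\<close>-valued points, the action \<open>X\<^sup>n \<mapsto> X\<^sup>n \<otimes> X\<^sup>n\<close> of \<open>A(M)\<close> on \<open>A(N)\<close> sends \<open>(g, \<phi>)\<close> to the
  homomorphism \<open>X\<^sup>n \<mapsto> g(X\<^sup>n) \<phi>(X\<^sup>n)\<close>; for \<open>N = M\<close> this is the multiplication of \<open>A(M)\<close>.\<close>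

definition toric_act ::
  "('m, 'e) monoid_scheme \<Rightarrow> 'm set \<Rightarrow> 'u ring
    \<Rightarrow> (('m \<Rightarrow> int) \<Rightarrow> 'u) \<Rightarrow> (('m \<Rightarrow> int) \<Rightarrow> 'u) \<Rightarrow> ('m \<Rightarrow> int) \<Rightarrow> 'u" where
  "toric_act M N R g \<phi> = char_hom M N R (\<lambda>n. g (Xpow n) \<otimes>\<^bsub>R\<^esub> \<phi> (Xpow n))"

definition toric_unit :: "('m, 'e) monoid_scheme \<Rightarrow> 'u ring \<Rightarrow> ('m \<Rightarrow> int) \<Rightarrow> 'u" where
  "toric_unit M R = char_hom M (carrier M) R (\<lambda>n. \<one>\<^bsub>R\<^esub>)"

text \<open>An action of the monoid scheme \<open>A(M)\<^sub>S\<close> on \<open>X\<close> over \<open>S\<close>.  The points of \<open>A(M)\<^sub>S \<times>\<^sub>S X\<close> are the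
  \<open>((g, s), x)\<close> with \<open>x\<close> lying over \<open>s\<close>.\<close>

definition is_action ::
  "('m, 'e) monoid_scheme \<Rightarrow> ('u, 's) rfun \<Rightarrow> ('u, 'x) rfun \<Rightarrow> ('u ring \<Rightarrow> 'x \<Rightarrow> 's)
    \<Rightarrow> ('u ring \<Rightarrow> ((('m \<Rightarrow> int) \<Rightarrow> 'u) \<times> 's) \<times> 'x \<Rightarrow> 'x) \<Rightarrow> bool" where
  "is_action M S X p a \<longleftrightarrow>
    (let G = AN M (carrier M) S in
      a \<in> mor (pullback G X (proj2 G) p) X \<and>
      (\<forall>R x g. cring R \<and> x \<in> obj X R \<and> g \<in> Hom (ZZ M (carrier M)) R \<longrightarrow>
         p R (a R ((g, p R x), x)) = p R x) \<and>
      (\<forall>R x. cring R \<and> x \<in> obj X R \<longrightarrow> a R ((toric_unit M R, p R x), x) = x) \<and>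
      (\<forall>R x g g'. cring R \<and> x \<in> obj X R \<and>
         g \<in> Hom (ZZ M (carrier M)) R \<and> g' \<in> Hom (ZZ M (carrier M)) R \<longrightarrow>
         a R ((toric_act M (carrier M) R g g', p R x), x) =
         a R ((g, p R x), a R ((g', p R x), x))))"

text \<open>The induced action of \<open>A(M)\<^sub>T\<close> on \<open>X\<^sub>T = X \<times>\<^sub>S T\<close>, where \<open>q : T \<rightarrow> S\<close>.\<close>

definition base_change_act ::
  "('u ring \<Rightarrow> 't \<Rightarrow> 's) \<Rightarrow> ('u ring \<Rightarrow> ((('m \<Rightarrow> int) \<Rightarrow> 'u) \<times> 's) \<times> 'x \<Rightarrow> 'x)
    \<Rightarrow> 'u ring \<Rightarrow> (('m \<Rightarrow> int) \<Rightarrow> 'u) \<Rightarrow> 'x \<times> 't \<Rightarrow> 'x \<times> 't" where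
  "base_change_act q a R g = (\<lambda>(x, t). (a R ((g, q R t), x), t))"


section \<open>Attractors\<close>

text \<open>\<open>attractor M X p a N T q\<close> is \<open>X\<^sup>N(T)\<close> for \<open>q : T \<rightarrow> S\<close>.\<close>

definition attractor ::
  "('m, 'e) monoid_scheme \<Rightarrow> ('u, 'x) rfun \<Rightarrow> ('u ring \<Rightarrow> 'x \<Rightarrow> 's)
    \<Rightarrow> ('u ring \<Rightarrow> ((('m \<Rightarrow> int) \<Rightarrow> 'u) \<times> 's) \<times> 'x \<Rightarrow> 'x) \<Rightarrow> 'm set
    \<Rightarrow> ('u, 't) rfun \<Rightarrow> ('u ring \<Rightarrow> 't \<Rightarrow> 's)
    \<Rightarrow> ('u ring \<Rightarrow> (('m \<Rightarrow> int) \<Rightarrow> 'u) \<times> 't \<Rightarrow> 'x \<times> 't) set" where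
  "attractor M X p a N T q =
    {f \<in> mor (AN M N T) (pullback X T p q).
       mcomp (AN M N T) (proj2 (pullback X T p q)) f = proj2 (AN M N T) \<and>
       (\<forall>R g \<phi> t. cring R \<and> g \<in> Hom (ZZ M (carrier M)) R \<and> (\<phi>, t) \<in> obj (AN M N T) R \<longrightarrow>
          f R (toric_act M N R g \<phi>, t) = base_change_act q a R g (f R (\<phi>, t)))}"

text \<open>Base change \<open>X\<^sup>N(T) \<rightarrow> X\<^sup>N(T')\<close> along \<open>u : T' \<rightarrow> T\<close>.\<close>

definition attractor_pullback ::
  "('m, 'e) monoid_scheme \<Rightarrow> 'm set \<Rightarrow> ('u, 't2) rfun \<Rightarrow> ('u ring \<Rightarrow> 't2 \<Rightarrow> 't)
    \<Rightarrow> ('u ring \<Rightarrow> (('m \<Rightarrow> int) \<Rightarrow> 'u) \<times> 't \<Rightarrow> 'x \<times> 't)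
    \<Rightarrow> 'u ring \<Rightarrow> (('m \<Rightarrow> int) \<Rightarrow> 'u) \<times> 't2 \<Rightarrow> 'x \<times> 't2" where
  "attractor_pullback M N T' u f =
    (\<lambda>R\<in>Collect cring. \<lambda>(\<phi>, t')\<in>obj (AN M N T') R. (fst (f R (\<phi>, u R t')), t'))"

text \<open>The morphism \<open>A(N')\<^sub>T \<rightarrow> A(N)\<^sub>T\<close> given by \<open>\<int>[N] \<subseteq> \<int>[N']\<close>, and precomposition with it.\<close>

definition AN_restrict ::
  "('m, 'e) monoid_scheme \<Rightarrow> 'm set \<Rightarrow> 'm set \<Rightarrow> ('u, 't) rfun
    \<Rightarrow> 'u ring \<Rightarrow> (('m \<Rightarrow> int) \<Rightarrow> 'u) \<times> 't \<Rightarrow> (('m \<Rightarrow> int) \<Rightarrow> 'u) \<times> 't" where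
  "AN_restrict M N N' T =
    (\<lambda>R\<in>Collect cring. \<lambda>(\<phi>, t)\<in>obj (AN M N' T) R. (restrict \<phi> (carrier (ZZ M N)), t))"

definition attractor_map ::
  "('m, 'e) monoid_scheme \<Rightarrow> 'm set \<Rightarrow> 'm set \<Rightarrow> ('u, 't) rfun
    \<Rightarrow> ('u ring \<Rightarrow> (('m \<Rightarrow> int) \<Rightarrow> 'u) \<times> 't \<Rightarrow> 'x \<times> 't)
    \<Rightarrow> 'u ring \<Rightarrow> (('m \<Rightarrow> int) \<Rightarrow> 'u) \<times> 't \<Rightarrow> 'x \<times> 't" where
  "attractor_map M N N' T f = mcomp (AN M N' T) f (AN_restrict M N N' T)"

end

(* A point (phi, t) of A(N)_T over R is the image of a
   universal point over R[N], so two morphisms f, f' : A(N)_T -> X_T over T agree once they agree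
   there.  By separatedness the locus where they agree at the universal point is V(I) for an ideal
   I of R[N].  If f and f' agree after restriction to A(N')_T, then I maps to zero in R[N'];
   since R[N] -> R[N'] is injective, I = 0.  As points are only available over rings with carrier in
   the universe 'u, R[N] and R[N'] have to be transported into 'u, which is possible because finitely
   supported functions 'u -> 'u inject into 'u when 'u is infinite. *)

theory Submission
  imports Defs "HOL-Algebra.Weak_Morphisms" "HOL-Algebra.Free_Abelian_Groups"
begin

section \<open>Monoid algebras\<close>

text \<open>The two morphisms cannot be compared at the given point itself: \<open>\<phi>\<close> on
  Z[N] need not extend to Z[N']. With N the nonnegative integers inside N' the integers, the map X
  to 0 into a nonzero ring has no extension. So A(N')_T -> A(N)_T is in general not surjective, only
  schematically dominant, and separatedness is what makes agreement after a dominant map sufficient.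
  Z[N] alone would not serve as the universal ring: the component \<open>t\<close> lives over R, and
  has to be carried along the structure map R -> R[N]. Evaluation R[N] -> R splits this map, so
  \<open>t\<close> comes back unchanged. Since R is an arbitrary commutative ring, the convolution
  product on R[N] must first be shown to be a ring structure. This is done by testing elements
  against linear functionals, and the same functionals, for multiplicative weights, later provide
  the evaluation map.\<close>

lemma (in abelian_monoid) finsum_Times:
  assumes "finite F" "finite K" "h \<in> F \<times> K \<rightarrow> carrier G"
  shows "(\<Oplus>z\<in>F \<times> K. h z) = (\<Oplus>k\<in>F. \<Oplus>l\<in>K. h (k, l))"
proof -
  \<comment> \<open>The product is cut into its slices over the points of \<open>F\<close>, which
    are disjoint.\<close>
  have "(\<Oplus>z\<in>F \<times> K. h z) = finsum G h (\<Union>k\<in>F. Pair k ` K)"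
    by (intro arg_cong[of _ _ "finsum G h"]) auto
  also have "\<dots> = (\<Oplus>k\<in>F. finsum G h (Pair k ` K))"
    using assms by (intro add.finprod_UN_disjoint) (auto simp: pairwise_def disjnt_def)
  also have "\<dots> = (\<Oplus>k\<in>F. \<Oplus>l\<in>K. h (k, l))"
  proof (intro finsum_cong' refl funcsetI)
    fix k assume "k \<in> F"
    then show "finsum G h (Pair k ` K) = (\<Oplus>l\<in>K. h (k, l))"
      using assms by (intro finsum_reindex) (auto simp: inj_on_def)
  next
    fix k assume "k \<in> F"
    then show "(\<Oplus>l\<in>K. h (k, l)) \<in> carrier G"
      using assms(3) by (intro finsum_closed) auto
  qed
  finally show ?thesis .
qed

text \<open>The R-linear functional on R[N] with X^n sent to \<open>w n\<close>. For arbitrary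
  \<open>w\<close> it is a test functional; for multiplicative \<open>w\<close> it is the evaluation
  homomorphism.\<close>

definition lineval :: "('a, 'c) ring_scheme \<Rightarrow> ('m \<Rightarrow> 'a) \<Rightarrow> ('m \<Rightarrow> 'a) \<Rightarrow> 'a" where
  "lineval R w f = (\<Oplus>\<^bsub>R\<^esub>n\<in>{n. f n \<noteq> \<zero>\<^bsub>R\<^esub>}. f n \<otimes>\<^bsub>R\<^esub> w n)"

text \<open>The monomial r X^m. The same function, with r = 1, also serves as the weight of the m-th
  coefficient functional.\<close>

definition single :: "('a, 'c) ring_scheme \<Rightarrow> 'a \<Rightarrow> 'm \<Rightarrow> 'm \<Rightarrow> 'a" where
  "single R r m = (\<lambda>n. if n = m then r else \<zero>\<^bsub>R\<^esub>)"

locale submonoid_algebra = cring R + M: comm_monoid M + N: submonoid N M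
  for R (structure) and M and N
begin

abbreviation RN where "RN \<equiv> monoid_algebra R M N"

lemma algebra_mem_iff: "f \<in> carrier RN \<longleftrightarrow>
    (\<forall>n. f n \<in> carrier R) \<and> finite {n. f n \<noteq> \<zero>} \<and> {n. f n \<noteq> \<zero>} \<subseteq> N"
  by (simp add: monoid_algebra_def)

lemma add_apply: "(f \<oplus>\<^bsub>RN\<^esub> g) n = f n \<oplus> g n"
  by (simp add: monoid_algebra_def)

lemma zero_apply: "\<zero>\<^bsub>RN\<^esub> n = \<zero>"
  by (simp add: monoid_algebra_def)

lemma one_apply: "\<one>\<^bsub>RN\<^esub> n = (if n = \<one>\<^bsub>M\<^esub> then \<one> else \<zero>)"
  by (simp add: monoid_algebra_def)

lemma mult_apply: "(f \<otimes>\<^bsub>RN\<^esub> g) n =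
    finsum R (\<lambda>(k, l). f k \<otimes> g l) {(k, l). f k \<noteq> \<zero> \<and> g l \<noteq> \<zero> \<and> k \<otimes>\<^bsub>M\<^esub> l = n}"
  by (simp add: monoid_algebra_def)

lemma coeff_closed: "f \<in> carrier RN \<Longrightarrow> f n \<in> carrier R"
  by (simp add: algebra_mem_iff)

lemma finite_supp [simp]: "f \<in> carrier RN \<Longrightarrow> finite {n. f n \<noteq> \<zero>}"
  by (simp add: algebra_mem_iff)

lemma supp_in: "f \<in> carrier RN \<Longrightarrow> f n \<noteq> \<zero> \<Longrightarrow> n \<in> N"
  by (auto simp add: algebra_mem_iff)

section \<open>Linear functionals on R[N] and the convolution product\<close>

lemma lineval_superset:
  assumes "f \<in> carrier RN" "finite K" "{n. f n \<noteq> \<zero>} \<subseteq> K" "w \<in> K \<rightarrow> carrier R"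
  shows "lineval R w f = (\<Oplus>n\<in>K. f n \<otimes> w n)"
  unfolding lineval_def using assms coeff_closed[OF assms(1)]
  by (intro add.finprod_mono_neutral_cong_left) (auto simp: Pi_iff)

lemma lineval_closed [simp]:
  "f \<in> carrier RN \<Longrightarrow> w \<in> N \<rightarrow> carrier R \<Longrightarrow> lineval R w f \<in> carrier R"
  unfolding lineval_def by (intro finsum_closed funcsetI m_closed) (auto dest: supp_in coeff_closed)

text \<open>Supports lie in \<open>N\<close>, so weights matter only there. This is what allows
  weights to be rewritten by the monoid laws, which hold only inside the carrier of
  \<open>M\<close>.\<close>

lemma lineval_cong:
  assumes "f \<in> carrier RN" "w' \<in> N \<rightarrow> carrier R" "\<And>n. n \<in> N \<Longrightarrow> w n = w' n"
  shows "lineval R w f = lineval R w' f"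
  unfolding lineval_def using assms coeff_closed[OF assms(1)] by (intro finsum_cong') (auto simp: Pi_iff dest: supp_in)

lemma algebra_add_closed:
  assumes "f \<in> carrier RN" "g \<in> carrier RN"
  shows "f \<oplus>\<^bsub>RN\<^esub> g \<in> carrier RN"
proof -
  note [simp] = coeff_closed[OF assms(1)] coeff_closed[OF assms(2)]
  have "{n. f n \<oplus> g n \<noteq> \<zero>} \<subseteq> {n. f n \<noteq> \<zero>} \<union> {n. g n \<noteq> \<zero>}" by auto
  moreover have "finite ({n. f n \<noteq> \<zero>} \<union> {n. g n \<noteq> \<zero>})" using assms by simp
  ultimately have "finite {n. f n \<oplus> g n \<noteq> \<zero>}" by (rule finite_subset)
  then show ?thesis
    using assms unfolding algebra_mem_iff add_apply by (auto simp: subset_iff) (metis l_zero zero_closed)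
qed

text \<open>If \<open>n\<close> is no product of support points, the convolution sum at
  \<open>n\<close> is empty. Cancellation can make the inclusion strict.\<close>

lemma supp_mult:
  assumes "f \<in> carrier RN" "g \<in> carrier RN"
  shows "{n. (f \<otimes>\<^bsub>RN\<^esub> g) n \<noteq> \<zero>} \<subseteq> (\<lambda>(k, l). k \<otimes>\<^bsub>M\<^esub> l) ` ({n. f n \<noteq> \<zero>} \<times> {n. g n \<noteq> \<zero>})"
proof
  note [simp] = coeff_closed[OF assms(1)] coeff_closed[OF assms(2)]
  fix n assume n: "n \<in> {n. (f \<otimes>\<^bsub>RN\<^esub> g) n \<noteq> \<zero>}"
  show "n \<in> (\<lambda>(k, l). k \<otimes>\<^bsub>M\<^esub> l) ` ({n. f n \<noteq> \<zero>} \<times> {n. g n \<noteq> \<zero>})"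
  proof (rule ccontr)
    assume "n \<notin> (\<lambda>(k, l). k \<otimes>\<^bsub>M\<^esub> l) ` ({n. f n \<noteq> \<zero>} \<times> {n. g n \<noteq> \<zero>})"
    then have empty: "{(k, l). f k \<noteq> \<zero> \<and> g l \<noteq> \<zero> \<and> k \<otimes>\<^bsub>M\<^esub> l = n} = {}" by force
    show False using n unfolding mem_Collect_eq mult_apply empty by simp
  qed
qed

lemma finite_supp_image:
  assumes "f \<in> carrier RN" "g \<in> carrier RN"
  shows "finite ((\<lambda>(k, l). k \<otimes>\<^bsub>M\<^esub> l) ` ({n. f n \<noteq> \<zero>} \<times> {n. g n \<noteq> \<zero>}))"
  using assms by simp

lemma algebra_mult_closed:
  assumes "f \<in> carrier RN" "g \<in> carrier RN"
  shows "f \<otimes>\<^bsub>RN\<^esub> g \<in> carrier RN"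
  unfolding algebra_mem_iff
proof (intro conjI allI)
  note [simp] = coeff_closed[OF assms(1)] coeff_closed[OF assms(2)]
  show "finite {n. (f \<otimes>\<^bsub>RN\<^esub> g) n \<noteq> \<zero>}"
    using finite_subset[OF supp_mult finite_supp_image] assms by blast
  show "{n. (f \<otimes>\<^bsub>RN\<^esub> g) n \<noteq> \<zero>} \<subseteq> N"
    using supp_mult[OF assms] assms by (auto dest!: subsetD intro: N.m_closed dest: supp_in)
  show "(f \<otimes>\<^bsub>RN\<^esub> g) n \<in> carrier R" for n
    unfolding mult_apply using assms by (intro finsum_closed) auto
qed

text \<open>Both sides sum f(k) g(l) w(kl) over all pairs of support points: the left groups the
  pairs by their product kl, the right by k. Everything about the convolution product except
  commutativity is derived from this identity.\<close>

lemma lineval_mult_nested: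
  assumes f: "f \<in> carrier RN" and g: "g \<in> carrier RN" and w: "w \<in> N \<rightarrow> carrier R"
  shows "lineval R w (f \<otimes>\<^bsub>RN\<^esub> g) = lineval R (\<lambda>k. lineval R (\<lambda>l. w (k \<otimes>\<^bsub>M\<^esub> l)) g) f"
proof -
  note [simp] = coeff_closed[OF f] coeff_closed[OF g]
  let ?F = "{n. f n \<noteq> \<zero>}" and ?G = "{n. g n \<noteq> \<zero>}"
  let ?mul = "\<lambda>(k, l). k \<otimes>\<^bsub>M\<^esub> l"
  let ?P = "?mul ` (?F \<times> ?G)"
  let ?I = "\<lambda>n. {(k, l). f k \<noteq> \<zero> \<and> g l \<noteq> \<zero> \<and> k \<otimes>\<^bsub>M\<^esub> l = n}"
  let ?h = "\<lambda>(k, l). f k \<otimes> g l \<otimes> w (k \<otimes>\<^bsub>M\<^esub> l)"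
  have FN: "?F \<subseteq> N" and GN: "?G \<subseteq> N" using f g by (auto dest: supp_in)
  have wP: "w (k \<otimes>\<^bsub>M\<^esub> l) \<in> carrier R" if "k \<in> N" "l \<in> N" for k l
    using that w by (auto intro: N.m_closed)
  have fin: "finite (?I n)" for n
    by (rule finite_subset[of _ "?F \<times> ?G"]) (use f g in auto)
  have [simp]: "w (k \<otimes>\<^bsub>M\<^esub> l) \<in> carrier R"
    if "f k \<noteq> \<zero>" "g l \<noteq> \<zero>" for k l
    using that FN GN wP by auto
  \<comment> \<open>The sum runs over all products of support points, not over the support of the
    product, because only the former is partitioned by the fibres \<open>?I n\<close>.\<close>
  have "lineval R w (f \<otimes>\<^bsub>RN\<^esub> g) = (\<Oplus>n\<in>?P. (f \<otimes>\<^bsub>RN\<^esub> g) n \<otimes> w n)"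
    using FN GN wP by (intro lineval_superset supp_mult finite_supp_image algebra_mult_closed f g) (auto simp: subset_iff)
  also have "\<dots> = (\<Oplus>n\<in>?P. finsum R ?h (?I n))"
  proof (intro finsum_cong' refl funcsetI)
    fix n assume "n \<in> ?P"
    then have wn: "w n \<in> carrier R" using FN GN wP by auto
    have "(f \<otimes>\<^bsub>RN\<^esub> g) n \<otimes> w n = (\<Oplus>z\<in>?I n. (case z of (k, l) \<Rightarrow> f k \<otimes> g l) \<otimes> w n)"
      unfolding mult_apply using wn fin f g by (intro finsum_ldistr) auto
    also have "\<dots> = finsum R ?h (?I n)"
      using FN GN wP f g by (intro finsum_cong') (auto simp: subset_iff)
    finally show "(f \<otimes>\<^bsub>RN\<^esub> g) n \<otimes> w n = finsum R ?h (?I n)" .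
  next
    fix n show "finsum R ?h (?I n) \<in> carrier R"
      by (intro finsum_closed) auto
  qed
  \<comment> \<open>The fibres of multiplication are disjoint and their union is the full product of
    the supports.\<close>
  also have "\<dots> = finsum R ?h (\<Union>n\<in>?P. ?I n)"
    using finite_supp_image[OF f g] fin
    by (intro add.finprod_UN_disjoint[symmetric]) (auto simp: pairwise_def disjnt_def)
  also have "(\<Union>n\<in>?P. ?I n) = ?F \<times> ?G" by auto
  also have "finsum R ?h (?F \<times> ?G) = (\<Oplus>k\<in>?F. \<Oplus>l\<in>?G. ?h (k, l))"
    using f g by (intro finsum_Times) auto
  also have "\<dots> = (\<Oplus>k\<in>?F. f k \<otimes> lineval R (\<lambda>l. w (k \<otimes>\<^bsub>M\<^esub> l)) g)"
  proof (intro finsum_cong' refl funcsetI)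
    fix k assume k: "k \<in> ?F"
    have "(\<Oplus>l\<in>?G. ?h (k, l)) = (\<Oplus>l\<in>?G. f k \<otimes> (g l \<otimes> w (k \<otimes>\<^bsub>M\<^esub> l)))"
      using k FN GN wP f g by (intro finsum_cong') (auto simp: m_assoc subset_iff)
    also have "\<dots> = f k \<otimes> lineval R (\<lambda>l. w (k \<otimes>\<^bsub>M\<^esub> l)) g"
      unfolding lineval_def using k FN GN wP f g
      by (intro finsum_rdistr[symmetric]) (auto simp: subset_iff)
    finally show "(\<Oplus>l\<in>?G. ?h (k, l)) = f k \<otimes> lineval R (\<lambda>l. w (k \<otimes>\<^bsub>M\<^esub> l)) g" .
  next
    fix k assume k: "k \<in> ?F"
    then show "f k \<otimes> lineval R (\<lambda>l. w (k \<otimes>\<^bsub>M\<^esub> l)) g \<in> carrier R"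
      using f g FN wP by (intro m_closed lineval_closed) auto
  qed
  also have "\<dots> = lineval R (\<lambda>k. lineval R (\<lambda>l. w (k \<otimes>\<^bsub>M\<^esub> l)) g) f"
    by (simp add: lineval_def)
  finally show ?thesis .
qed

lemma lineval_add:
  assumes f: "f \<in> carrier RN" and g: "g \<in> carrier RN" and w: "w \<in> N \<rightarrow> carrier R"
  shows "lineval R w (f \<oplus>\<^bsub>RN\<^esub> g) = lineval R w f \<oplus> lineval R w g"
proof -
  note [simp] = coeff_closed[OF f] coeff_closed[OF g]
  let ?K = "{n. f n \<noteq> \<zero>} \<union> {n. g n \<noteq> \<zero>}"
  have K: "finite ?K" "?K \<subseteq> N" using f g by (auto dest: supp_in)
  have wK: "w \<in> ?K \<rightarrow> carrier R" using K(2) w by auto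
  have "lineval R w (f \<oplus>\<^bsub>RN\<^esub> g) = (\<Oplus>n\<in>?K. (f \<oplus>\<^bsub>RN\<^esub> g) n \<otimes> w n)"
    using wK K algebra_add_closed[OF f g] by (intro lineval_superset) (auto simp: add_apply)
  also have "\<dots> = (\<Oplus>n\<in>?K. f n \<otimes> w n \<oplus> g n \<otimes> w n)"
    using f g wK by (intro finsum_cong') (auto simp: add_apply l_distr Pi_iff)
  also have "\<dots> = (\<Oplus>n\<in>?K. f n \<otimes> w n) \<oplus> (\<Oplus>n\<in>?K. g n \<otimes> w n)"
    using f g wK by (intro finsum_addf) (auto simp: Pi_iff)
  also have "(\<Oplus>n\<in>?K. f n \<otimes> w n) = lineval R w f"
    using f wK K by (intro lineval_superset[symmetric]) auto
  also have "(\<Oplus>n\<in>?K. g n \<otimes> w n) = lineval R w g"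
    using g wK K by (intro lineval_superset[symmetric]) auto
  finally show ?thesis .
qed

section \<open>Monomials, coefficients and the ring axioms of R[N]\<close>

lemma single_closed [simp, intro]:
  assumes "r \<in> carrier R" "m \<in> N"
  shows "single R r m \<in> carrier RN"
proof -
  have "{n. single R r m n \<noteq> \<zero>} \<subseteq> {m}" by (auto simp: single_def)
  moreover from this have "finite {n. single R r m n \<noteq> \<zero>}" by (rule finite_subset) simp
  ultimately show ?thesis using assms unfolding algebra_mem_iff by (auto simp: single_def)
qed

lemma one_eq_single: "\<one>\<^bsub>RN\<^esub> = single R \<one> \<one>\<^bsub>M\<^esub>"
  by (simp add: single_def fun_eq_iff one_apply)

lemma lineval_single:
  assumes "r \<in> carrier R" "m \<in> N" "w m \<in> carrier R"
  shows "lineval R w (single R r m) = r \<otimes> w m"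
proof -
  have "lineval R w (single R r m) = (\<Oplus>n\<in>{m}. single R r m n \<otimes> w n)"
    using assms by (intro lineval_superset single_closed) (auto simp: single_def)
  also have "\<dots> = r \<otimes> w m"
    using assms by (subst finsum_insert) (auto simp: single_def)
  finally show ?thesis .
qed

text \<open>Coefficients are themselves linear functionals, with the indicator of \<open>m\<close>
  as weight; hence functionals separate elements.\<close>

lemma lineval_coeff:
  assumes f: "f \<in> carrier RN"
  shows "lineval R (single R \<one> m) f = f m"
proof -
  note [simp] = coeff_closed[OF f]
  \<comment> \<open>Inserting \<open>m\<close> covers the case where \<open>f m\<close> vanishes and
    \<open>m\<close> is outside the support.\<close>
  have "lineval R (single R \<one> m) f = (\<Oplus>n\<in>insert m {n. f n \<noteq> \<zero>}. f n \<otimes> single R \<one> m n)"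
    using f by (intro lineval_superset) (auto simp: single_def)
  also have "\<dots> = (\<Oplus>n\<in>insert m {n. f n \<noteq> \<zero>}. if m = n then f n else \<zero>)"
    using f by (intro finsum_cong') (auto simp: single_def)
  also have "\<dots> = f m"
    using f by (intro finsum_singleton) auto
  finally show ?thesis .
qed

text \<open>Linear functionals separate points, so the ring axioms of \<open>R[N]\<close> reduce to identities between
  iterated functionals and no convolution sum has to be rearranged.\<close>

lemma algebra_eqI:
  assumes "f \<in> carrier RN" "g \<in> carrier RN"
    and "\<And>w. w \<in> N \<rightarrow> carrier R \<Longrightarrow> lineval R w f = lineval R w g"
  shows "f = g"
proof
  note [simp] = coeff_closed[OF assms(1)] coeff_closed[OF assms(2)]
  fix m
  have "single R \<one> m \<in> N \<rightarrow> carrier R" by (auto simp: single_def)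
  then show "f m = g m" using assms lineval_coeff by metis
qed

lemma lineval_rmult:
  assumes "f \<in> carrier RN" "w \<in> N \<rightarrow> carrier R" "c \<in> carrier R"
  shows "lineval R (\<lambda>n. w n \<otimes> c) f = lineval R w f \<otimes> c"
  unfolding lineval_def using assms supp_in[OF assms(1)] coeff_closed[OF assms(1)]
  by (subst finsum_ldistr) (auto intro!: finsum_cong' simp: m_assoc Pi_iff)

text \<open>Here coefficients are compared directly: swapping the pairs is a bijection between the
  two index sets.\<close>

lemma algebra_mult_comm:
  assumes f: "f \<in> carrier RN" and g: "g \<in> carrier RN"
  shows "f \<otimes>\<^bsub>RN\<^esub> g = g \<otimes>\<^bsub>RN\<^esub> f"
proof
  note [simp] = coeff_closed[OF f] coeff_closed[OF g]
  fix n
  let ?I = "\<lambda>f g. {(k, l). f k \<noteq> \<zero> \<and> g l \<noteq> \<zero> \<and> k \<otimes>\<^bsub>M\<^esub> l = n}"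
  have "?I g f = prod.swap ` ?I f g"
    using f g by (force simp: image_iff intro: M.m_comm dest: supp_in)
  then have "(g \<otimes>\<^bsub>RN\<^esub> f) n = finsum R (\<lambda>(k, l). g k \<otimes> f l) (prod.swap ` ?I f g)"
    by (simp add: mult_apply)
  also have "\<dots> = (\<Oplus>z\<in>?I f g. case prod.swap z of (k, l) \<Rightarrow> g k \<otimes> f l)"
    using f g by (intro finsum_reindex) auto
  also have "\<dots> = (f \<otimes>\<^bsub>RN\<^esub> g) n"
    unfolding mult_apply using f g by (intro finsum_cong') (auto simp: m_comm)
  finally show "(f \<otimes>\<^bsub>RN\<^esub> g) n = (g \<otimes>\<^bsub>RN\<^esub> f) n" ..
qed

text \<open>Applied twice, \<open>lineval_mult_nested\<close> turns each side into a threefold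
  iterated functional; the two differ only in the bracketing of the argument of
  \<open>w\<close>.\<close>

lemma algebra_mult_assoc:
  assumes f: "f \<in> carrier RN" and g: "g \<in> carrier RN" and h: "h \<in> carrier RN"
  shows "f \<otimes>\<^bsub>RN\<^esub> g \<otimes>\<^bsub>RN\<^esub> h = f \<otimes>\<^bsub>RN\<^esub> (g \<otimes>\<^bsub>RN\<^esub> h)"
proof (rule algebra_eqI)
  note [simp] = coeff_closed[OF f] coeff_closed[OF g] coeff_closed[OF h]
  fix w assume w: "w \<in> N \<rightarrow> carrier R"
  have w1: "(\<lambda>l. w (k \<otimes>\<^bsub>M\<^esub> l)) \<in> N \<rightarrow> carrier R" if "k \<in> N" for k
    using w that by (auto intro: N.m_closed)
  have "lineval R w (f \<otimes>\<^bsub>RN\<^esub> g \<otimes>\<^bsub>RN\<^esub> h) =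
      lineval R (\<lambda>m. lineval R (\<lambda>r. w (m \<otimes>\<^bsub>M\<^esub> r)) h) (f \<otimes>\<^bsub>RN\<^esub> g)"
    by (intro lineval_mult_nested algebra_mult_closed f g h w)
  also have "\<dots> = lineval R (\<lambda>k. lineval R (\<lambda>l. lineval R (\<lambda>r. w (k \<otimes>\<^bsub>M\<^esub> l \<otimes>\<^bsub>M\<^esub> r)) h) g) f"
    using h w1 by (intro lineval_mult_nested f g) auto
  also have "\<dots> = lineval R (\<lambda>k. lineval R (\<lambda>m. w (k \<otimes>\<^bsub>M\<^esub> m)) (g \<otimes>\<^bsub>RN\<^esub> h)) f"
  proof (intro lineval_cong f funcsetI)
    fix k assume k: "k \<in> N"
    then show "lineval R (\<lambda>m. w (k \<otimes>\<^bsub>M\<^esub> m)) (g \<otimes>\<^bsub>RN\<^esub> h) \<in> carrier R"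
      by (intro lineval_closed algebra_mult_closed g h w1)
    have "lineval R (\<lambda>m. w (k \<otimes>\<^bsub>M\<^esub> m)) (g \<otimes>\<^bsub>RN\<^esub> h) =
        lineval R (\<lambda>l. lineval R (\<lambda>r. w (k \<otimes>\<^bsub>M\<^esub> (l \<otimes>\<^bsub>M\<^esub> r))) h) g"
      using k by (intro lineval_mult_nested g h w1)
    also have "\<dots> = lineval R (\<lambda>l. lineval R (\<lambda>r. w (k \<otimes>\<^bsub>M\<^esub> l \<otimes>\<^bsub>M\<^esub> r)) h) g"
      using k by (intro lineval_cong g h) (auto intro!: lineval_closed h w1 simp: M.m_assoc)
    finally show "lineval R (\<lambda>l. lineval R (\<lambda>r. w (k \<otimes>\<^bsub>M\<^esub> l \<otimes>\<^bsub>M\<^esub> r)) h) g =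
      lineval R (\<lambda>m. w (k \<otimes>\<^bsub>M\<^esub> m)) (g \<otimes>\<^bsub>RN\<^esub> h)" by simp
  qed
  also have "\<dots> = lineval R w (f \<otimes>\<^bsub>RN\<^esub> (g \<otimes>\<^bsub>RN\<^esub> h))"
    by (intro lineval_mult_nested[symmetric] algebra_mult_closed f g h w)
  finally show "lineval R w (f \<otimes>\<^bsub>RN\<^esub> g \<otimes>\<^bsub>RN\<^esub> h) = lineval R w (f \<otimes>\<^bsub>RN\<^esub> (g \<otimes>\<^bsub>RN\<^esub> h))" .
qed (intro algebra_mult_closed f g h)+

lemma algebra_one_closed: "\<one>\<^bsub>RN\<^esub> \<in> carrier RN"
  unfolding one_eq_single by (intro single_closed) auto

lemma algebra_l_one:
  assumes f: "f \<in> carrier RN"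
  shows "\<one>\<^bsub>RN\<^esub> \<otimes>\<^bsub>RN\<^esub> f = f"
proof (rule algebra_eqI)
  note [simp] = coeff_closed[OF f]
  fix w assume w: "w \<in> N \<rightarrow> carrier R"
  have w1: "lineval R (\<lambda>l. w (\<one>\<^bsub>M\<^esub> \<otimes>\<^bsub>M\<^esub> l)) f = lineval R w f"
    using f w by (intro lineval_cong) auto
  have "lineval R w (\<one>\<^bsub>RN\<^esub> \<otimes>\<^bsub>RN\<^esub> f) = lineval R (\<lambda>k. lineval R (\<lambda>l. w (k \<otimes>\<^bsub>M\<^esub> l)) f) \<one>\<^bsub>RN\<^esub>"
    using algebra_one_closed f w by (intro lineval_mult_nested)
  also have "\<dots> = lineval R (\<lambda>l. w (\<one>\<^bsub>M\<^esub> \<otimes>\<^bsub>M\<^esub> l)) f"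
    unfolding one_eq_single using w1 f w by (subst lineval_single) auto
  finally show "lineval R w (\<one>\<^bsub>RN\<^esub> \<otimes>\<^bsub>RN\<^esub> f) = lineval R w f" by (simp add: w1)
qed (intro algebra_mult_closed algebra_one_closed f)+

text \<open>With \<open>h\<close> and \<open>w\<close> fixed, multiplying by \<open>h\<close> and
  applying \<open>w\<close> is again a linear functional of the first factor, so additivity of
  \<open>lineval\<close> suffices.\<close>

lemma algebra_distr:
  assumes f: "f \<in> carrier RN" and g: "g \<in> carrier RN" and h: "h \<in> carrier RN"
  shows "(f \<oplus>\<^bsub>RN\<^esub> g) \<otimes>\<^bsub>RN\<^esub> h = f \<otimes>\<^bsub>RN\<^esub> h \<oplus>\<^bsub>RN\<^esub> g \<otimes>\<^bsub>RN\<^esub> h"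
proof (rule algebra_eqI)
  note [simp] = coeff_closed[OF f] coeff_closed[OF g] coeff_closed[OF h]
  fix w assume w: "w \<in> N \<rightarrow> carrier R"
  have "(\<lambda>k. lineval R (\<lambda>l. w (k \<otimes>\<^bsub>M\<^esub> l)) h) \<in> N \<rightarrow> carrier R"
    using w h by (auto intro!: lineval_closed N.m_closed)
  then show "lineval R w ((f \<oplus>\<^bsub>RN\<^esub> g) \<otimes>\<^bsub>RN\<^esub> h) = lineval R w (f \<otimes>\<^bsub>RN\<^esub> h \<oplus>\<^bsub>RN\<^esub> g \<otimes>\<^bsub>RN\<^esub> h)"
    using f g h w by (simp add: lineval_mult_nested lineval_add algebra_add_closed algebra_mult_closed)
qed (intro algebra_mult_closed algebra_add_closed f g h)+

lemma algebra_zero_closed: "\<zero>\<^bsub>RN\<^esub> \<in> carrier RN"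
  by (simp add: algebra_mem_iff zero_apply)

lemma cring_monoid_algebra: "cring RN"
proof (intro cringI abelian_groupI comm_monoidI)
  fix f assume f: "f \<in> carrier RN"
  note [simp] = coeff_closed[OF f]
  have "{n. \<ominus> f n \<noteq> \<zero>} = {n. f n \<noteq> \<zero>}"
    using f by (metis (no_types, lifting) coeff_closed[OF f] minus_minus minus_zero)
  then have "(\<lambda>n. \<ominus> f n) \<in> carrier RN"
    using f by (auto simp: algebra_mem_iff)
  moreover have "(\<lambda>n. \<ominus> f n) \<oplus>\<^bsub>RN\<^esub> f = \<zero>\<^bsub>RN\<^esub>"
    using f by (auto simp: fun_eq_iff add_apply zero_apply l_neg)
  ultimately show "\<exists>g\<in>carrier RN. g \<oplus>\<^bsub>RN\<^esub> f = \<zero>\<^bsub>RN\<^esub>" by blast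
qed (auto simp: algebra_add_closed algebra_mult_closed algebra_zero_closed algebra_one_closed algebra_l_one algebra_distr
    algebra_mult_assoc fun_eq_iff add_apply zero_apply coeff_closed a_ac intro: algebra_mult_comm[THEN fun_cong])

text \<open>Multiplicativity of \<open>w\<close> lets the factor \<open>w k\<close> be pulled out of
  the inner functional, and the nested expression becomes a product. This is the existence half of
  the universal property of R[N].\<close>

lemma lineval_ring_hom:
  assumes w: "w \<in> N \<rightarrow> carrier R" "w \<one>\<^bsub>M\<^esub> = \<one>"
    and mul: "\<And>k l. k \<in> N \<Longrightarrow> l \<in> N \<Longrightarrow> w (k \<otimes>\<^bsub>M\<^esub> l) = w k \<otimes> w l"
  shows "lineval R w \<in> ring_hom RN R"
proof (rule ring_hom_memI)
  fix f g assume f: "f \<in> carrier RN" and g: "g \<in> carrier RN"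
  have "lineval R w (f \<otimes>\<^bsub>RN\<^esub> g) = lineval R (\<lambda>k. lineval R (\<lambda>l. w (k \<otimes>\<^bsub>M\<^esub> l)) g) f"
    using f g w by (intro lineval_mult_nested)
  also have "\<dots> = lineval R (\<lambda>k. w k \<otimes> lineval R w g) f"
  proof (intro lineval_cong f funcsetI)
    fix k assume k: "k \<in> N"
    then have wk: "w k \<in> carrier R" using w by auto
    have "lineval R (\<lambda>l. w (k \<otimes>\<^bsub>M\<^esub> l)) g = lineval R (\<lambda>l. w l \<otimes> w k) g"
      using k wk w by (intro lineval_cong g) (auto simp: mul m_comm Pi_iff)
    then show "lineval R (\<lambda>l. w (k \<otimes>\<^bsub>M\<^esub> l)) g = w k \<otimes> lineval R w g"
      using wk w g by (simp add: lineval_rmult m_comm)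
  qed (use w g in auto)
  also have "\<dots> = lineval R w f \<otimes> lineval R w g"
    using f g w by (intro lineval_rmult) auto
  finally show "lineval R w (f \<otimes>\<^bsub>RN\<^esub> g) = lineval R w f \<otimes> lineval R w g" .
next
  show "lineval R w \<one>\<^bsub>RN\<^esub> = \<one>"
    unfolding one_eq_single using w by (subst lineval_single) auto
qed (use w in \<open>auto simp: lineval_add\<close>)

end

section \<open>Homomorphisms out of integral monoid algebras\<close>

lemma (in ring) int_multiple_ring_hom: "(\<lambda>k::int. [k] \<cdot> \<one>) \<in> ring_hom \<Z> R"
proof (rule ring_hom_memI)
  fix k l :: int
  have "[k] \<cdot> \<one> \<otimes> [l] \<cdot> \<one> = [k] \<cdot> ([l] \<cdot> \<one>)"
    by (simp add: add_pow_ldistr_int)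
  then show "[(k \<otimes>\<^bsub>\<Z>\<^esub> l)] \<cdot> \<one> = [k] \<cdot> \<one> \<otimes> [l] \<cdot> \<one>"
    by (simp add: add.int_pow_pow mult.commute)
qed (simp_all add: add.int_pow_mult)

lemma add_pow_zero_int [simp]: "[(0::int)] \<cdot>\<^bsub>R\<^esub> x = \<zero>\<^bsub>R\<^esub>"
  by (simp add: add_pow_def)

section \<open>Change of coefficients\<close>

lemma submonoid_algebraI:
  "cring R \<Longrightarrow> comm_monoid M \<Longrightarrow> submonoid N M \<Longrightarrow> submonoid_algebra R M N"
  by (simp add: submonoid_algebra_def)

lemma coeff_map_closed:
  assumes A: "submonoid_algebra A M N" and R: "submonoid_algebra R M N"
    and k: "k \<in> ring_hom A R" and f: "f \<in> carrier (monoid_algebra A M N)"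
  shows "k \<circ> f \<in> carrier (monoid_algebra R M N)"
proof -
  interpret A: submonoid_algebra A M N by fact
  interpret R: submonoid_algebra R M N by fact
  have "k \<zero>\<^bsub>A\<^esub> = \<zero>\<^bsub>R\<^esub>"
    using k by (simp add: ring_hom_zero A.ring_axioms R.ring_axioms)
  then have sub: "{n. (k \<circ> f) n \<noteq> \<zero>\<^bsub>R\<^esub>} \<subseteq> {n. f n \<noteq> \<zero>\<^bsub>A\<^esub>}" by auto
  then have "finite {n. (k \<circ> f) n \<noteq> \<zero>\<^bsub>R\<^esub>}"
    using finite_subset A.finite_supp[OF f] by blast
  then show ?thesis
    using sub A.supp_in[OF f] ring_hom_closed[OF k A.coeff_closed[OF f]]
    by (auto simp: R.algebra_mem_iff)
qed

text \<open>Needed for the unique homomorphism from the integers to R, where it yields the canonical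
  map Z[N] -> R[N].\<close>

lemma coeff_map_ring_hom:
  assumes A: "submonoid_algebra A M N" and R: "submonoid_algebra R M N"
    and k: "k \<in> ring_hom A R"
  shows "(\<lambda>f. k \<circ> f) \<in> ring_hom (monoid_algebra A M N) (monoid_algebra R M N)"
proof (rule ring_hom_memI)
  interpret A: submonoid_algebra A M N by fact
  interpret R: submonoid_algebra R M N by fact
  interpret k: ring_hom_cring A R k
    using k by unfold_locales
  show "k \<circ> \<one>\<^bsub>monoid_algebra A M N\<^esub> = \<one>\<^bsub>monoid_algebra R M N\<^esub>"
    by (auto simp: A.one_apply R.one_apply fun_eq_iff)
  fix f g assume f: "f \<in> carrier (monoid_algebra A M N)" and g: "g \<in> carrier (monoid_algebra A M N)"
  show "k \<circ> f \<in> carrier (monoid_algebra R M N)"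
    using coeff_map_closed[OF A R k f] .
  show "k \<circ> (f \<oplus>\<^bsub>monoid_algebra A M N\<^esub> g) = (k \<circ> f) \<oplus>\<^bsub>monoid_algebra R M N\<^esub> (k \<circ> g)"
    by (auto simp: fun_eq_iff A.add_apply R.add_apply A.coeff_closed[OF f] A.coeff_closed[OF g])
  show "k \<circ> (f \<otimes>\<^bsub>monoid_algebra A M N\<^esub> g) = (k \<circ> f) \<otimes>\<^bsub>monoid_algebra R M N\<^esub> (k \<circ> g)"
  proof
    fix n
    let ?I = "{(k, l). f k \<noteq> \<zero>\<^bsub>A\<^esub> \<and> g l \<noteq> \<zero>\<^bsub>A\<^esub> \<and> k \<otimes>\<^bsub>M\<^esub> l = n}"
    let ?J = "{(a, b). k (f a) \<noteq> \<zero>\<^bsub>R\<^esub> \<and> k (g b) \<noteq> \<zero>\<^bsub>R\<^esub> \<and> a \<otimes>\<^bsub>M\<^esub> b = n}"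
    note [simp] = A.coeff_closed[OF f] A.coeff_closed[OF g]
    have fin: "finite ?I"
      by (rule finite_subset[of _ "{n. f n \<noteq> \<zero>\<^bsub>A\<^esub>} \<times> {n. g n \<noteq> \<zero>\<^bsub>A\<^esub>}"])
        (use A.finite_supp[OF f] A.finite_supp[OF g] in auto)
    have "(k \<circ> (f \<otimes>\<^bsub>monoid_algebra A M N\<^esub> g)) n = k (finsum A (\<lambda>(k, l). f k \<otimes>\<^bsub>A\<^esub> g l) ?I)"
      by (simp add: A.mult_apply)
    also have "\<dots> = finsum R (k \<circ> (\<lambda>(k, l). f k \<otimes>\<^bsub>A\<^esub> g l)) ?I"
      by (intro k.hom_finsum) auto
    \<comment> \<open>The index set can shrink, because \<open>k\<close> may kill nonzero
      coefficients; the terms dropped are zero.\<close>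
    also have "\<dots> = finsum R (\<lambda>(a, b). k (f a) \<otimes>\<^bsub>R\<^esub> k (g b)) ?J"
      using fin by (intro R.add.finprod_mono_neutral_cong_right) auto
    also have "\<dots> = ((k \<circ> f) \<otimes>\<^bsub>monoid_algebra R M N\<^esub> (k \<circ> g)) n"
      by (simp add: R.mult_apply)
    finally show "(k \<circ> (f \<otimes>\<^bsub>monoid_algebra A M N\<^esub> g)) n = ((k \<circ> f) \<otimes>\<^bsub>monoid_algebra R M N\<^esub> (k \<circ> g)) n" .
  qed
qed

text \<open>The canonical map Z[N] -> R[N], reducing each integer coefficient to R.\<close>

abbreviation int_coeffs :: "('a, 'c) ring_scheme \<Rightarrow> ('m \<Rightarrow> int) \<Rightarrow> 'm \<Rightarrow> 'a" where
  "int_coeffs R f \<equiv> (\<lambda>k::int. [k] \<cdot>\<^bsub>R\<^esub> \<one>\<^bsub>R\<^esub>) \<circ> f"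

context submonoid_algebra
begin

lemma single_mult:
  assumes "r \<in> carrier R" "s \<in> carrier R" "m \<in> N" "n \<in> N"
  shows "single R r m \<otimes>\<^bsub>RN\<^esub> single R s n = single R (r \<otimes> s) (m \<otimes>\<^bsub>M\<^esub> n)"
proof (rule algebra_eqI)
  fix w assume w: "w \<in> N \<rightarrow> carrier R"
  then have wmn: "w (m \<otimes>\<^bsub>M\<^esub> n) \<in> carrier R" using assms by (auto intro: N.m_closed)
  have "lineval R w (single R r m \<otimes>\<^bsub>RN\<^esub> single R s n) =
      lineval R (\<lambda>k. lineval R (\<lambda>l. w (k \<otimes>\<^bsub>M\<^esub> l)) (single R s n)) (single R r m)"
    using assms w by (intro lineval_mult_nested) auto
  also have "\<dots> = lineval R w (single R (r \<otimes> s) (m \<otimes>\<^bsub>M\<^esub> n))"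
    using assms wmn by (simp add: lineval_single m_assoc)
  finally show "lineval R w (single R r m \<otimes>\<^bsub>RN\<^esub> single R s n) =
      lineval R w (single R (r \<otimes> s) (m \<otimes>\<^bsub>M\<^esub> n))" .
qed (use assms in \<open>auto intro!: algebra_mult_closed\<close>)

end

locale toric_ring = submonoid_algebra R M N for R :: "'a ring" (structure) and M and N
begin

lemma int_submonoid_algebra: "submonoid_algebra \<Z> M N"
  by (intro submonoid_algebraI int_is_cring M.comm_monoid_axioms N.submonoid_axioms)

sublocale Z: submonoid_algebra \<Z> M N
  by (rule int_submonoid_algebra)

lemma int_coeffs_ring_hom: "int_coeffs R \<in> ring_hom (ZZ M N) RN"
  by (intro coeff_map_ring_hom int_submonoid_algebra submonoid_algebra_axioms int_multiple_ring_hom)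

lemma int_coeffs_closed: "f \<in> carrier (ZZ M N) \<Longrightarrow> int_coeffs R f \<in> carrier RN"
  using int_coeffs_ring_hom by (rule ring_hom_closed)

text \<open>Factors the map out of Z[N] through R[N], so that its ring homomorphism property follows
  from that of the two factors.\<close>

lemma char_hom_eq_lineval:
  assumes f: "f \<in> carrier (ZZ M N)" and c: "c \<in> N \<rightarrow> carrier R"
  shows "char_hom M N R c f = lineval R c (int_coeffs R f)"
proof -
  have N: "{n. f n \<noteq> 0} \<subseteq> N" and fin: "finite {n. f n \<noteq> 0}"
    using f Z.algebra_mem_iff[of f] by auto
  \<comment> \<open>In positive characteristic the support of \<open>int_coeffs R f\<close> can be
    smaller than that of \<open>f\<close>, hence the detour through
    \<open>lineval_superset\<close>.\<close>
  have "lineval R c (int_coeffs R f) = (\<Oplus>n\<in>{n. f n \<noteq> 0}. int_coeffs R f n \<otimes> c n)"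
    using N c fin by (intro lineval_superset int_coeffs_closed f) auto
  also have "\<dots> = (\<Oplus>n\<in>{n. f n \<noteq> 0}. [f n] \<cdot> c n)"
    using N c by (intro finsum_cong') (auto simp: add_pow_ldistr_int Pi_iff subset_iff)
  finally show ?thesis using f by (simp add: char_hom_def)
qed

lemma char_hom_Hom:
  assumes c: "c \<in> N \<rightarrow> carrier R" "c \<one>\<^bsub>M\<^esub> = \<one>"
    and mul: "\<And>k l. k \<in> N \<Longrightarrow> l \<in> N \<Longrightarrow> c (k \<otimes>\<^bsub>M\<^esub> l) = c k \<otimes> c l"
  shows "char_hom M N R c \<in> Hom (ZZ M N) R"
proof -
  have "lineval R c \<circ> int_coeffs R \<in> ring_hom (ZZ M N) R"
    using int_coeffs_ring_hom lineval_ring_hom[OF assms] by (rule ring_hom_trans)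
  then have "char_hom M N R c \<in> ring_hom (ZZ M N) R"
    by (rule ring.ring_hom_restrict[OF Z.cring_monoid_algebra[THEN cring.axioms(1)]])
      (simp add: char_hom_eq_lineval c)
  then show ?thesis by (simp add: Hom_def char_hom_def)
qed

lemma Xpow_eq_single: "Xpow n = single \<Z> 1 n"
  by (simp add: Xpow_def single_def fun_eq_iff)

lemma Xpow_closed [simp]: "n \<in> N \<Longrightarrow> Xpow n \<in> carrier (ZZ M N)"
  unfolding Xpow_eq_single by (rule Z.single_closed) auto

lemma Hom_Xpow:
  assumes "\<phi> \<in> Hom (ZZ M N) R"
  shows "(\<lambda>n. \<phi> (Xpow n)) \<in> N \<rightarrow> carrier R" "\<phi> (Xpow \<one>\<^bsub>M\<^esub>) = \<one>"
    "\<And>k l. k \<in> N \<Longrightarrow> l \<in> N \<Longrightarrow> \<phi> (Xpow (k \<otimes>\<^bsub>M\<^esub> l)) = \<phi> (Xpow k) \<otimes> \<phi> (Xpow l)"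
proof -
  have \<phi>: "\<phi> \<in> ring_hom (ZZ M N) R" using assms by (simp add: Hom_def)
  show "(\<lambda>n. \<phi> (Xpow n)) \<in> N \<rightarrow> carrier R"
    using ring_hom_closed[OF \<phi>] by simp
  show "\<phi> (Xpow \<one>\<^bsub>M\<^esub>) = \<one>"
    using ring_hom_one[OF \<phi>] by (simp add: Z.one_eq_single Xpow_eq_single)
  fix k l assume kl: "k \<in> N" "l \<in> N"
  then have "Xpow (k \<otimes>\<^bsub>M\<^esub> l) = Xpow k \<otimes>\<^bsub>ZZ M N\<^esub> Xpow l"
    unfolding Xpow_eq_single by (subst Z.single_mult) auto
  then show "\<phi> (Xpow (k \<otimes>\<^bsub>M\<^esub> l)) = \<phi> (Xpow k) \<otimes> \<phi> (Xpow l)"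
    using kl by (simp add: ring_hom_mult[OF \<phi>])
qed

end

section \<open>Points of A(N) as characters of N\<close>

context toric_ring
begin

text \<open>The X^n generate Z[N] as an additive group, so a homomorphism is determined by its
  values on them. This gives the uniqueness needed to recover \<open>\<phi>\<close> from its
  character.\<close>

lemma Hom_eq_char_hom:
  assumes "\<phi> \<in> Hom (ZZ M N) R"
  shows "char_hom M N R (\<lambda>n. \<phi> (Xpow n)) = \<phi>"
proof
  fix f
  have \<phi>: "\<phi> \<in> ring_hom (ZZ M N) R" using assms by (simp add: Hom_def)
  interpret ZN: cring "ZZ M N" by (rule Z.cring_monoid_algebra)
  note Xc = Hom_Xpow(1)[OF assms]
  \<comment> \<open>Integer multiples of X^n are handled by induction upwards and downwards from 0;
    the downward step cancels one copy of X^n.\<close>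
  have single: "\<phi> (single \<Z> k n) = [k] \<cdot> \<phi> (Xpow n)" if n: "n \<in> N" for k n
  proof (induction k rule: int_induct[where k = 0])
    case base
    have "single \<Z> 0 n = \<zero>\<^bsub>ZZ M N\<^esub>" by (simp add: single_def fun_eq_iff Z.zero_apply)
    then show ?case by (simp add: ring_hom_zero[OF \<phi> ZN.ring_axioms ring_axioms])
  next
    case (step1 i)
    have "single \<Z> (i + 1) n = single \<Z> i n \<oplus>\<^bsub>ZZ M N\<^esub> Xpow n"
      by (simp add: single_def Xpow_def fun_eq_iff Z.add_apply)
    then have "\<phi> (single \<Z> (i + 1) n) = [i] \<cdot> \<phi> (Xpow n) \<oplus> \<phi> (Xpow n)"
      using n by (simp add: ring_hom_add[OF \<phi>] step1 Z.single_closed)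
    then show ?case using n Xc by (simp add: add.int_pow_mult Pi_iff)
  next
    case (step2 i)
    have "single \<Z> i n = single \<Z> (i - 1) n \<oplus>\<^bsub>ZZ M N\<^esub> Xpow n"
      by (simp add: single_def Xpow_def fun_eq_iff Z.add_apply)
    then have "[(i - 1 + 1)] \<cdot> \<phi> (Xpow n) = \<phi> (single \<Z> (i - 1) n) \<oplus> \<phi> (Xpow n)"
      using n by (simp add: ring_hom_add[OF \<phi>] step2(2)[symmetric] Z.single_closed)
    then have "[(i - 1)] \<cdot> \<phi> (Xpow n) \<oplus> \<phi> (Xpow n) = \<phi> (single \<Z> (i - 1) n) \<oplus> \<phi> (Xpow n)"
      using n Xc by (simp only: add.int_pow_mult add.int_pow_1 Pi_iff)
    then show ?case
      using n Xc by (simp add: Pi_iff ring_hom_closed[OF \<phi>] Z.single_closed)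
  qed
  \<comment> \<open>The claim is made for any finite \<open>K\<close> containing the support, so
    that the induction can split off one monomial whether or not its coefficient is zero.\<close>
  have sum: "\<phi> f = (\<Oplus>n\<in>K. [f n] \<cdot> \<phi> (Xpow n))"
    if "finite K" "K \<subseteq> N" "f \<in> carrier (ZZ M N)" "{n. f n \<noteq> 0} \<subseteq> K" for K f
    using that
  proof (induction K arbitrary: f)
    case empty
    then have "f = \<zero>\<^bsub>ZZ M N\<^esub>" by (auto simp: fun_eq_iff Z.zero_apply)
    then show ?case by (simp add: ring_hom_zero[OF \<phi> ZN.ring_axioms ring_axioms])
  next
    case (insert m K)
    let ?g = "f(m := 0)"
    have g: "?g \<in> carrier (ZZ M N)" "{n. ?g n \<noteq> 0} \<subseteq> K"
      using insert.prems insert.hyps by (auto simp: Z.algebra_mem_iff intro: finite_subset)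
    have XK: "(\<lambda>n. [f n] \<cdot> \<phi> (Xpow n)) \<in> insert m K \<rightarrow> carrier R"
      using insert.prems Xc by (auto simp: Pi_iff subset_iff)
    have "f = single \<Z> (f m) m \<oplus>\<^bsub>ZZ M N\<^esub> ?g"
      by (simp add: fun_eq_iff single_def Z.add_apply)
    then have "\<phi> f = \<phi> (single \<Z> (f m) m) \<oplus> \<phi> ?g"
      using insert.prems g(1) ring_hom_add[OF \<phi> Z.single_closed g(1)]
      by (metis Z.single_closed insert_subset iso_tuple_UNIV_I partial_object.select_convs(1))
    also have "\<dots> = [f m] \<cdot> \<phi> (Xpow m) \<oplus> (\<Oplus>n\<in>K. [?g n] \<cdot> \<phi> (Xpow n))"
      using insert.prems g by (simp only: single insert.IH insert_subset)
    also have "(\<Oplus>n\<in>K. [?g n] \<cdot> \<phi> (Xpow n)) = (\<Oplus>n\<in>K. [f n] \<cdot> \<phi> (Xpow n))"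
      using insert.hyps XK by (intro finsum_cong') auto
    also have "[f m] \<cdot> \<phi> (Xpow m) \<oplus> \<dots> = (\<Oplus>n\<in>insert m K. [f n] \<cdot> \<phi> (Xpow n))"
      using insert.hyps XK by (subst finsum_insert) auto
    finally show ?case .
  qed
  show "char_hom M N R (\<lambda>n. \<phi> (Xpow n)) f = \<phi> f"
  proof (cases "f \<in> carrier (ZZ M N)")
    case True
    then show ?thesis
      using sum[of "{n. f n \<noteq> 0}" f] by (simp add: char_hom_def Z.algebra_mem_iff)
  next
    case False
    then show ?thesis
      using assms by (simp add: char_hom_def Hom_def extensional_def)
  qed
qed

text \<open>A pointwise product of two characters is a character because multiplication in R is
  commutative; \<open>g\<close> enters through its restriction from the carrier of \<open>M\<close>
  to \<open>N\<close>.\<close>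

lemma toric_act_Hom:
  assumes g: "g \<in> Hom (ZZ M (carrier M)) R" and \<phi>: "\<phi> \<in> Hom (ZZ M N) R"
  shows "toric_act M N R g \<phi> \<in> Hom (ZZ M N) R"
proof -
  interpret MM: toric_ring R M "carrier M"
    by unfold_locales auto
  note G = MM.Hom_Xpow[OF g] and P = Hom_Xpow[OF \<phi>]
  have c: "g (Xpow n) \<in> carrier R" "\<phi> (Xpow n) \<in> carrier R" if "n \<in> N" for n
    using that G(1) P(1) by auto
  show ?thesis
    unfolding toric_act_def
  proof (rule char_hom_Hom)
    fix k l assume kl: "k \<in> N" "l \<in> N"
    then show "g (Xpow (k \<otimes>\<^bsub>M\<^esub> l)) \<otimes> \<phi> (Xpow (k \<otimes>\<^bsub>M\<^esub> l)) =
        g (Xpow k) \<otimes> \<phi> (Xpow k) \<otimes> (g (Xpow l) \<otimes> \<phi> (Xpow l))"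
      using c[OF kl(1)] c[OF kl(2)] by (simp add: G(3) P(3) m_ac)
  qed (use c G(2) P(2) in auto)
qed

end

section \<open>Restriction to a smaller submonoid\<close>

lemma monoid_algebra_mono:
  "N \<subseteq> N' \<Longrightarrow> carrier (monoid_algebra R M N) \<subseteq> carrier (monoid_algebra R M N')"
  by (auto simp: monoid_algebra_def)

text \<open>Only the carrier depends on the submonoid. Hence Z[N] is literally a subring of Z[N'],
  and composing with the inclusion is plain restriction of functions.\<close>

lemma monoid_algebra_sel:
  "mult (monoid_algebra R M N') = mult (monoid_algebra R M N)"
  "add (monoid_algebra R M N') = add (monoid_algebra R M N)"
  "one (monoid_algebra R M N') = one (monoid_algebra R M N)"
  "ring.zero (monoid_algebra R M N') = ring.zero (monoid_algebra R M N)"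
  by (simp_all add: monoid_algebra_def)

lemma restrict_Hom:
  assumes "toric_ring R M N" "N \<subseteq> N'" and \<phi>: "\<phi> \<in> Hom (ZZ M N') R"
  shows "restrict \<phi> (carrier (ZZ M N)) \<in> Hom (ZZ M N) R"
proof -
  interpret toric_ring R M N by fact
  have \<phi>': "\<phi> \<in> ring_hom (ZZ M N') R" using \<phi> by (simp add: Hom_def)
  note mono = subsetD[OF monoid_algebra_mono[OF \<open>N \<subseteq> N'\<close>]]
  note sel = monoid_algebra_sel[where N = N and N' = N']
  have "restrict \<phi> (carrier (ZZ M N)) \<in> ring_hom (ZZ M N) R"
    using ring_hom_closed[OF \<phi>'] ring_hom_mult[OF \<phi>'] ring_hom_add[OF \<phi>'] ring_hom_one[OF \<phi>']
    by (intro ring_hom_memI)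
      (auto simp: mono Z.algebra_mult_closed Z.algebra_add_closed Z.algebra_one_closed sel)
  then show ?thesis by (simp add: Hom_def)
qed

text \<open>Equivariance of A(N') -> A(N): the defining sum of \<open>char_hom\<close> at
  \<open>f\<close> involves only exponents in the support of \<open>f\<close>, which lies in
  \<open>N\<close>.\<close>

lemma restrict_toric_act:
  assumes "toric_ring R M N" "toric_ring R M N'" "N \<subseteq> N'"
    and g: "g \<in> Hom (ZZ M (carrier M)) R" and \<phi>: "\<phi> \<in> Hom (ZZ M N') R"
  shows "restrict (toric_act M N' R g \<phi>) (carrier (ZZ M N)) =
    toric_act M N R g (restrict \<phi> (carrier (ZZ M N)))"
proof
  fix f
  interpret N: toric_ring R M N by fact
  interpret N': toric_ring R M N' by fact
  interpret MM: toric_ring R M "carrier M"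
    by unfold_locales auto
  note mono = subsetD[OF monoid_algebra_mono[OF \<open>N \<subseteq> N'\<close>]]
  have c: "g (Xpow n) \<in> carrier R" "\<phi> (Xpow n) \<in> carrier R" if "n \<in> N" for n
    using that \<open>N \<subseteq> N'\<close> MM.Hom_Xpow(1)[OF g] N'.Hom_Xpow(1)[OF \<phi>] N.N.subset by auto
  show "restrict (toric_act M N' R g \<phi>) (carrier (ZZ M N)) f =
    toric_act M N R g (restrict \<phi> (carrier (ZZ M N))) f"
  proof (cases "f \<in> carrier (ZZ M N)")
    case True
    then have "n \<in> N" if "f n \<noteq> 0" for n using that by (auto simp: N.Z.algebra_mem_iff)
    then show ?thesis
      using True mono[OF True] c
      by (auto simp: toric_act_def char_hom_def intro!: N.finsum_cong')
  qed (simp add: toric_act_def char_hom_def)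
qed

section \<open>The universal point of a diagonalizable monoid scheme\<close>

text \<open>Such a function is recovered from its finite graph over the support, its value elsewhere
  being \<open>z\<close>. Finite subsets of an infinite set are equinumerous with that set, and so
  are pairs.\<close>

lemma ex_inj_on_finite_support:
  assumes "infinite (UNIV :: 'u set)"
  shows "\<exists>e :: ('u \<Rightarrow> 'u) \<Rightarrow> 'u. inj_on e {f. finite {n. f n \<noteq> z}}"
proof -
  let ?g = "\<lambda>f :: 'u \<Rightarrow> 'u. (\<lambda>n. (n, f n)) ` {n. f n \<noteq> z}"
  have "inj ?g"
  proof (rule injI)
    fix f f' assume eq: "?g f = ?g f'"
    show "f = f'"
    proof
      fix n
      have "(n, f n) \<in> ?g f' \<or> f n = z" "(n, f' n) \<in> ?g f \<or> f' n = z"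
        using eq by auto
      then show "f n = f' n" by auto
    qed
  qed
  obtain b :: "'u \<times> 'u \<Rightarrow> 'u" where b: "bij b"
    using Times_same_infinite_bij_betw_types[OF assms] by blast
  have "infinite (UNIV :: ('u \<times> 'u) set)"
    using assms by (simp add: finite_prod)
  then obtain c :: "('u \<times> 'u) set \<Rightarrow> 'u \<times> 'u" where c: "inj_on c (Fpow UNIV)"
    using eqpoll_Fpow unfolding eqpoll_def bij_betw_def by blast
  have "inj_on (b \<circ> c \<circ> ?g) {f. finite {n. f n \<noteq> z}}"
  proof (intro comp_inj_on)
    show "inj_on ?g {f. finite {n. f n \<noteq> z}}" using \<open>inj ?g\<close> by (rule inj_on_subset) simp
    show "inj_on c (?g ` {f. finite {n. f n \<noteq> z}})"
      by (rule inj_on_subset[OF c]) (auto simp: Fpow_def)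
    show "inj_on b (c ` ?g ` {f. finite {n. f n \<noteq> z}})"
      using b by (auto simp: bij_def intro: inj_on_subset)
  qed
  then show ?thesis by blast
qed

lemma (in cring) cring_image_ring:
  assumes "inj_on f (carrier R)" shows "cring (image_ring f R)"
  using ring_iso_imp_img_cring[OF inj_imp_image_ring_iso[OF assms]]
  by (simp add: image_ring_def image_group_def monoid.defs)

text \<open>\<open>B\<close> and \<open>C\<close> are copies of \<open>R[N]\<close> and \<open>R[N']\<close> inside \<open>'u\<close>, \<open>u\<close> and \<open>u'\<close> the canonical maps from
  \<open>\<int>[N]\<close> and \<open>\<int>[N']\<close>, and \<open>ev\<close> is the \<open>R\<close>-algebra map induced by \<open>\<phi>\<close>.\<close>

lemma universal_point:
  fixes R :: "'u ring" and M :: "('u, 'e) monoid_scheme"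
  assumes inf: "infinite (UNIV :: 'u set)"
    and R: "cring R" and M: "comm_monoid M" and N: "submonoid N M" and N': "submonoid N' M"
    and sub: "N \<subseteq> N'" and \<phi>: "\<phi> \<in> Hom (ZZ M N) R"
  obtains B C :: "'u ring" and i u u' h ev where
    "cring B" "cring C" "i \<in> Hom R B" "u \<in> Hom (ZZ M N) B" "u' \<in> Hom (ZZ M N') C"
    "h \<in> Hom B C" "inj_on h (carrier B)" "ev \<in> Hom B R"
    "compose (carrier (ZZ M N)) h u = restrict u' (carrier (ZZ M N))"
    "compose (carrier R) ev i = (\<lambda>r\<in>carrier R. r)"
    "compose (carrier (ZZ M N)) ev u = \<phi>"
proof -
  interpret N: toric_ring R M N
    by (simp add: toric_ring_def submonoid_algebra_def R M N)
  interpret N': toric_ring R M N'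
    by (simp add: toric_ring_def submonoid_algebra_def R M N')
  let ?A = "monoid_algebra R M N" and ?A' = "monoid_algebra R M N'"
  interpret A: cring ?A by (rule N.cring_monoid_algebra)
  interpret A': cring ?A' by (rule N'.cring_monoid_algebra)
  \<comment> \<open>One encoding \<open>e\<close> serves both algebras. Thus the copy of R[N] lies
    inside the copy of R[N'], and \<open>h\<close> can be the identity on elements, trivially
    injective.\<close>
  obtain e :: "('u \<Rightarrow> 'u) \<Rightarrow> 'u" where "inj_on e {f. finite {n. f n \<noteq> \<zero>\<^bsub>R\<^esub>}}"
    using ex_inj_on_finite_support[OF inf] by blast
  then have e: "inj_on e (carrier ?A)" and e': "inj_on e (carrier ?A')"
    by (auto elim!: inj_on_subset dest: N.finite_supp N'.finite_supp simp del: N.finite_supp N'.finite_supp)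
  define B where "B = image_ring e ?A"
  define C where "C = image_ring e ?A'"
  have carB: "carrier B = e ` carrier ?A" and carC: "carrier C = e ` carrier ?A'"
    by (simp_all add: B_def C_def image_ring_carrier)
  have eB: "e \<in> ring_hom ?A B" and eC: "e \<in> ring_hom ?A' C"
    using inj_imp_image_ring_iso[OF e] inj_imp_image_ring_iso[OF e']
    by (simp_all add: B_def C_def ring_iso_def)
  have cB: "cring B" and cC: "cring C"
    unfolding B_def C_def by (rule A.cring_image_ring[OF e], rule A'.cring_image_ring[OF e'])
  interpret B: cring B by (rule cB)
  note ZNr = N.Z.cring_monoid_algebra[THEN cring.axioms(1)]
    and ZNr' = N'.Z.cring_monoid_algebra[THEN cring.axioms(1)]
  \<comment> \<open>The structure map of the R-algebra: r goes to the constant r X^1, with 1 the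
    unit of \<open>M\<close>.\<close>
  define i where "i = (\<lambda>r\<in>carrier R. e (single R r \<one>\<^bsub>M\<^esub>))"
  define u where "u = (\<lambda>f\<in>carrier (ZZ M N). e (int_coeffs R f))"
  define u' where "u' = (\<lambda>f\<in>carrier (ZZ M N'). e (int_coeffs R f))"
  define h where "h = (\<lambda>b\<in>carrier B. b)"
  define w where "w = (\<lambda>n. \<phi> (Xpow n))"
  \<comment> \<open>An element is decoded to R[N] and then evaluated at the character of
    \<open>\<phi>\<close>.\<close>
  define ev where "ev = (\<lambda>b\<in>carrier B. lineval R w (inv_into (carrier ?A) e b))"
  have w: "w \<in> N \<rightarrow> carrier R" "w \<one>\<^bsub>M\<^esub> = \<one>\<^bsub>R\<^esub>"
    "\<And>k l. k \<in> N \<Longrightarrow> l \<in> N \<Longrightarrow> w (k \<otimes>\<^bsub>M\<^esub> l) = w k \<otimes>\<^bsub>R\<^esub> w l"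
    using N.Hom_Xpow[OF \<phi>] by (simp_all add: w_def)
  note mono = subsetD[OF monoid_algebra_mono[OF sub]]
  note sel = monoid_algebra_sel[where N = N and N' = N']
  have "(\<lambda>r. single R r \<one>\<^bsub>M\<^esub>) \<in> ring_hom R ?A"
    by (rule ring_hom_memI)
      (auto simp: N.single_mult N.one_eq_single fun_eq_iff N.add_apply, auto simp: single_def)
  from ring_hom_trans[OF this eB] have "i \<in> Hom R B"
    unfolding Hom_def i_def by (auto intro: N.ring_hom_restrict)
  moreover have u: "u \<in> Hom (ZZ M N) B"
    using ring_hom_trans[OF N.int_coeffs_ring_hom eB]
    unfolding Hom_def u_def by (auto intro: ring.ring_hom_restrict[OF ZNr])
  moreover have "u' \<in> Hom (ZZ M N') C"
    using ring_hom_trans[OF N'.int_coeffs_ring_hom eC]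
    unfolding Hom_def u'_def by (auto intro: ring.ring_hom_restrict[OF ZNr'])
  moreover have "h \<in> Hom B C"
  proof -
    have "h \<in> ring_hom B C"
    proof (rule ring_hom_memI)
      show "h \<one>\<^bsub>B\<^esub> = \<one>\<^bsub>C\<^esub>"
        by (simp add: h_def ring_hom_one[OF eB, symmetric] ring_hom_one[OF eC, symmetric] sel
            ring_hom_closed[OF eB])
      fix x y assume "x \<in> carrier B" "y \<in> carrier B"
      then obtain a b where ab: "a \<in> carrier ?A" "x = e a" "b \<in> carrier ?A" "y = e b"
        unfolding carB by blast
      then show "h x \<in> carrier C" by (auto simp: h_def carB carC mono)
      show "h (x \<otimes>\<^bsub>B\<^esub> y) = h x \<otimes>\<^bsub>C\<^esub> h y"
        using ab by (simp add: h_def ring_hom_mult[OF eB, symmetric] ring_hom_closed[OF eB]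
            ring_hom_mult[OF eC, symmetric] mono sel)
      show "h (x \<oplus>\<^bsub>B\<^esub> y) = h x \<oplus>\<^bsub>C\<^esub> h y"
        using ab by (simp add: h_def ring_hom_add[OF eB, symmetric] ring_hom_closed[OF eB]
            ring_hom_add[OF eC, symmetric] mono sel)
    qed
    then show ?thesis by (simp add: Hom_def h_def)
  qed
  moreover have "inj_on h (carrier B)" by (auto simp: h_def inj_on_def)
  moreover have "ev \<in> Hom B R"
  proof -
    have inv: "inv_into (carrier ?A) e \<in> ring_hom B ?A"
      using ring_iso_set_sym[OF A.ring_axioms inj_imp_image_ring_iso[OF e]]
      by (simp add: B_def ring_iso_def)
    show ?thesis
      using ring_hom_trans[OF inv N.lineval_ring_hom[OF w]]
      unfolding Hom_def ev_def by (auto intro: B.ring_hom_restrict)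
  qed
  moreover have "compose (carrier (ZZ M N)) h u = restrict u' (carrier (ZZ M N))"
    by (auto simp: fun_eq_iff compose_def h_def u_def u'_def carB mono N.int_coeffs_closed)
  moreover have "compose (carrier R) ev i = (\<lambda>r\<in>carrier R. r)"
    using w by (auto simp: fun_eq_iff compose_def ev_def i_def carB inv_into_f_f[OF e] N.lineval_single)
  moreover have "compose (carrier (ZZ M N)) ev u = \<phi>"
  proof
    fix f
    show "compose (carrier (ZZ M N)) ev u f = \<phi> f"
    proof (cases "f \<in> carrier (ZZ M N)")
      case True
      then have "compose (carrier (ZZ M N)) ev u f = lineval R w (int_coeffs R f)"
        by (simp add: compose_def ev_def u_def carB N.int_coeffs_closed inv_into_f_f[OF e] del: o_apply)
      also have "\<dots> = \<phi> f"
        using N.char_hom_eq_lineval[OF True w(1)] N.Hom_eq_char_hom[OF \<phi>] by (simp add: w_def)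
      finally show ?thesis .
    next
      case False
      then show ?thesis using \<phi> by (simp add: compose_def Hom_def extensional_def)
    qed
  qed
  ultimately show ?thesis using that cB cC by blast
qed

section \<open>Natural transformations and separatedness\<close>

lemma mor_closed: "\<alpha> \<in> mor F G \<Longrightarrow> cring A \<Longrightarrow> x \<in> obj F A \<Longrightarrow> \<alpha> A x \<in> obj G A"
  unfolding mor_def by blast

lemma mor_natural:
  "\<alpha> \<in> mor F G \<Longrightarrow> cring A \<Longrightarrow> cring B \<Longrightarrow> h \<in> Hom A B \<Longrightarrow> x \<in> obj F A \<Longrightarrow>
    \<alpha> B (arr F A B h x) = arr G A B h (\<alpha> A x)"
  unfolding mor_def by blast

lemma mor_eqI:
  fixes F :: "('a, 'b) rfun"
  assumes "\<alpha> \<in> mor F G" "\<beta> \<in> mor F G"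
    and "\<And>A x. cring A \<Longrightarrow> x \<in> obj F A \<Longrightarrow> \<alpha> A x = \<beta> A x"
  shows "\<alpha> = \<beta>"
proof -
  have "\<alpha> \<in> (\<Pi>\<^sub>E A\<in>Collect cring. obj F A \<rightarrow>\<^sub>E obj G A)" "\<beta> \<in> (\<Pi>\<^sub>E A\<in>Collect cring. obj F A \<rightarrow>\<^sub>E obj G A)"
    using assms by (simp_all add: mor_def)
  then show ?thesis
  proof (rule PiE_ext)
    fix A :: "'a ring" assume "A \<in> Collect cring"
    then have "\<alpha> A \<in> obj F A \<rightarrow>\<^sub>E obj G A" "\<beta> A \<in> obj F A \<rightarrow>\<^sub>E obj G A"
      using assms(1,2) by (auto simp: mor_def)
    then show "\<alpha> A = \<beta> A"
      by (rule PiE_ext) (use assms(3) \<open>A \<in> Collect cring\<close> in auto)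
  qed
qed

lemma ring_functor_closed:
  "ring_functor F \<Longrightarrow> cring A \<Longrightarrow> cring B \<Longrightarrow> h \<in> Hom A B \<Longrightarrow> x \<in> obj F A \<Longrightarrow> arr F A B h x \<in> obj F B"
  unfolding ring_functor_def by blast

lemma ring_functor_id:
  "ring_functor F \<Longrightarrow> cring A \<Longrightarrow> x \<in> obj F A \<Longrightarrow> arr F A A (\<lambda>a\<in>carrier A. a) x = x"
  unfolding ring_functor_def by blast

lemma ring_functor_comp:
  "ring_functor F \<Longrightarrow> cring A \<Longrightarrow> cring B \<Longrightarrow> cring C \<Longrightarrow> h \<in> Hom A B \<Longrightarrow> k \<in> Hom B C \<Longrightarrow>
    x \<in> obj F A \<Longrightarrow> arr F B C k (arr F A B h x) = arr F A C (compose (carrier A) k h) x"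
  unfolding ring_functor_def by metis

lemma mcomp_apply: "cring A \<Longrightarrow> x \<in> obj F A \<Longrightarrow> mcomp F \<beta> \<alpha> A x = \<beta> A (\<alpha> A x)"
  by (simp add: mcomp_def compose_def)

lemma mcomp_mor:
  fixes F :: "('a, 'b) rfun"
  assumes F: "ring_functor F" and \<alpha>: "\<alpha> \<in> mor F G" and \<beta>: "\<beta> \<in> mor G H"
  shows "mcomp F \<beta> \<alpha> \<in> mor F H"
  unfolding mor_def
proof (intro CollectI conjI allI impI)
  show "mcomp F \<beta> \<alpha> \<in> (\<Pi>\<^sub>E A\<in>Collect cring. obj F A \<rightarrow>\<^sub>E obj H A)"
    using mor_closed[OF \<alpha>] mor_closed[OF \<beta>] by (auto simp: mcomp_def compose_def)
  fix A B :: "'a ring" and h x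
  assume "cring A \<and> cring B \<and> h \<in> Hom A B \<and> x \<in> obj F A"
  then show "mcomp F \<beta> \<alpha> B (arr F A B h x) = arr H A B h (mcomp F \<beta> \<alpha> A x)"
    using mor_closed[OF \<alpha>]
    by (simp add: mcomp_apply ring_functor_closed[OF F] mor_natural[OF \<alpha>] mor_natural[OF \<beta>])
qed

lemma id_Hom: "(\<lambda>a\<in>carrier A. a) \<in> Hom A A"
  if "ring A"
  using ring.ring_hom_restrict[OF that id_ring_hom] by (simp add: Hom_def)

lemma compose_Hom:
  assumes "ring A" "h \<in> Hom A B" "k \<in> Hom B C"
  shows "compose (carrier A) k h \<in> Hom A C"
proof -
  have "k \<circ> h \<in> ring_hom A C" using assms ring_hom_trans by (auto simp: Hom_def)
  then have "compose (carrier A) k h \<in> ring_hom A C"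
    by (rule ring.ring_hom_restrict[OF assms(1)]) (simp add: compose_def)
  then show ?thesis by (simp add: Hom_def compose_def)
qed

text \<open>Two points over the same point of \<open>S\<close> that agree after an injective ring
  map are equal. The ideal I of their agreement locus is killed by \<open>h\<close>, hence zero, so
  the identity of \<open>B\<close> is a point of V(I); agreement there is equality.\<close>

lemma separated_over_eqI:
  assumes sep: "separated_over S X p" and X: "ring_functor X"
    and B: "cring B" and C: "cring C" and h: "h \<in> Hom B C" "inj_on h (carrier B)"
    and xy: "x \<in> obj X B" "y \<in> obj X B" "p B x = p B y" "arr X B C h x = arr X B C h y"
  shows "x = y"
proof -
  have mem: "(x, y) \<in> obj (pullback X X p p) B"
    using xy by (simp add: pullback_def)
  then obtain I where I: "ideal I B"
    and V: "\<And>D k. cring D \<Longrightarrow> k \<in> Hom B D \<Longrightarrow>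
      arr (pullback X X p p) B D k (x, y) \<in> diagonal X D ` obj X D \<longleftrightarrow> k ` I \<subseteq> {\<zero>\<^bsub>D\<^esub>}"
    using sep B unfolding separated_over_def closed_immersion_def by meson
  \<comment> \<open>Lying in the image of the diagonal just means that the two pulled-back points
    agree.\<close>
  have diag: "arr (pullback X X p p) B D k (x, y) \<in> diagonal X D ` obj X D \<longleftrightarrow>
      arr X B D k x = arr X B D k y" if "cring D" "k \<in> Hom B D" for D k
    using that ring_functor_closed[OF X B that xy(1)]
    by (auto simp: pullback_def diagonal_def image_iff)
  interpret B: cring B by (rule B)
  interpret C: cring C by (rule C)
  have hr: "h \<in> ring_hom B C" using h by (simp add: Hom_def)
  have "h ` I \<subseteq> {\<zero>\<^bsub>C\<^esub>}" using V[OF C h(1)] diag[OF C h(1)] xy(4) by simp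
  moreover have "I \<subseteq> carrier B" using I by (rule ideal.Icarr[THEN subsetI])
  moreover have "h \<zero>\<^bsub>B\<^esub> = \<zero>\<^bsub>C\<^esub>" by (rule ring_hom_zero[OF hr B.ring_axioms C.ring_axioms])
  ultimately have "I \<subseteq> {\<zero>\<^bsub>B\<^esub>}" using h(2) B.zero_closed by (auto simp: inj_on_def subset_iff)
  then have "(\<lambda>a\<in>carrier B. a) ` I \<subseteq> {\<zero>\<^bsub>B\<^esub>}" by auto
  then show ?thesis
    using V[OF B id_Hom[OF B.ring_axioms]] diag[OF B id_Hom[OF B.ring_axioms]]
    by (simp add: ring_functor_id[OF X B] xy)
qed

section \<open>Attractors\<close>

lemma obj_AN [simp]: "obj (AN M N T) R = Hom (ZZ M N) R \<times> obj T R"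
  by (simp add: AN_def fprod_def Spec_def)

lemma arr_AN [simp]:
  "arr (AN M N T) R R' k (\<phi>, t) = (compose (carrier (ZZ M N)) k \<phi>, arr T R R' k t)"
  by (simp add: AN_def fprod_def Spec_def)

lemma obj_pullback [simp]:
  "(x, y) \<in> obj (pullback F G \<alpha> \<beta>) R \<longleftrightarrow> x \<in> obj F R \<and> y \<in> obj G R \<and> \<alpha> R x = \<beta> R y"
  by (simp add: pullback_def)

lemma arr_pullback [simp]:
  "arr (pullback F G \<alpha> \<beta>) R R' k (x, y) = (arr F R R' k x, arr G R R' k y)"
  by (simp add: pullback_def)

lemma ring_ZZ: "comm_monoid M \<Longrightarrow> submonoid N M \<Longrightarrow> ring (ZZ M N)"
  by (intro cring.axioms(1) submonoid_algebra.cring_monoid_algebra submonoid_algebraI int_is_cring)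

lemma ring_functor_AN:
  assumes M: "comm_monoid M" "submonoid N M" and T: "ring_functor T"
  shows "ring_functor (AN M N T)"
  unfolding ring_functor_def
proof (intro conjI allI impI)
  note rZ = ring_ZZ[OF M]
  show "arr (AN M N T) A B h \<in> obj (AN M N T) A \<rightarrow> obj (AN M N T) B"
    if "cring A \<and> cring B \<and> h \<in> Hom A B" for A B h
    using that by (auto simp: compose_Hom[OF rZ] ring_functor_closed[OF T])
  show "arr (AN M N T) A A (\<lambda>a\<in>carrier A. a) x = x" if prem: "cring A \<and> x \<in> obj (AN M N T) A" for A x
  proof -
    obtain \<phi> t where x: "x = (\<phi>, t)" "\<phi> \<in> Hom (ZZ M N) A" "t \<in> obj T A" "cring A"
      using prem by auto
    have "compose (carrier (ZZ M N)) (\<lambda>a\<in>carrier A. a) \<phi> = \<phi>"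
      using x(2) by (auto simp: fun_eq_iff compose_def Hom_def extensional_def dest: ring_hom_closed)
    then show ?thesis using x by (simp add: ring_functor_id[OF T])
  qed
  show "arr (AN M N T) A C (compose (carrier A) k h) x = arr (AN M N T) B C k (arr (AN M N T) A B h x)"
    if prem: "cring A \<and> cring B \<and> cring C \<and> h \<in> Hom A B \<and> k \<in> Hom B C \<and> x \<in> obj (AN M N T) A"
    for A B C h k x
  proof -
    obtain \<phi> t where x: "x = (\<phi>, t)" "\<phi> \<in> Hom (ZZ M N) A" "t \<in> obj T A"
      using prem by (cases x) auto
    have "compose (carrier (ZZ M N)) (compose (carrier A) k h) \<phi> =
        compose (carrier (ZZ M N)) k (compose (carrier (ZZ M N)) h \<phi>)"
      using x(2) by (auto simp: fun_eq_iff compose_def Hom_def dest: ring_hom_closed)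
    then show ?thesis using x that by (simp add: ring_functor_comp[OF T])
  qed
qed

lemma AN_restrict_apply:
  "cring R \<Longrightarrow> \<phi> \<in> Hom (ZZ M N') R \<Longrightarrow> t \<in> obj T R \<Longrightarrow>
    AN_restrict M N N' T R (\<phi>, t) = (restrict \<phi> (carrier (ZZ M N)), t)"
  by (simp add: AN_restrict_def)

lemma toric_ringI: "cring R \<Longrightarrow> comm_monoid M \<Longrightarrow> submonoid N M \<Longrightarrow> toric_ring R M N"
  by (simp add: toric_ring_def submonoid_algebra_def)

lemma AN_restrict_mor:
  fixes T :: "('u, 't) rfun"
  assumes M: "comm_monoid M" "submonoid N M" "submonoid N' M" "N \<subseteq> N'" and T: "ring_functor T"
  shows "AN_restrict M N N' T \<in> mor (AN M N' T) (AN M N T)"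
  unfolding mor_def
proof (intro CollectI conjI allI impI)
  have res: "restrict \<phi> (carrier (ZZ M N)) \<in> Hom (ZZ M N) R"
    if "cring R" "\<phi> \<in> Hom (ZZ M N') R" for R :: "'u ring" and \<phi>
    by (rule restrict_Hom[OF toric_ringI[OF that(1) M(1,2)] M(4) that(2)])
  show "AN_restrict M N N' T \<in> (\<Pi>\<^sub>E R\<in>Collect cring. obj (AN M N' T) R \<rightarrow>\<^sub>E obj (AN M N T) R)"
    by (auto simp: AN_restrict_def res split: if_splits)
  fix A B :: "'u ring" and h x
  assume "cring A \<and> cring B \<and> h \<in> Hom A B \<and> x \<in> obj (AN M N' T) A"
  then obtain \<phi> t where *: "cring A" "cring B" "h \<in> Hom A B" "x = (\<phi>, t)" "\<phi> \<in> Hom (ZZ M N') A" "t \<in> obj T A"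
    by auto
  have "compose (carrier (ZZ M N')) h \<phi> \<in> Hom (ZZ M N') B"
    using * by (intro compose_Hom[OF ring_ZZ[OF M(1,3)]])
  then show "AN_restrict M N N' T B (arr (AN M N' T) A B h x) = arr (AN M N T) A B h (AN_restrict M N N' T A x)"
    using * subsetD[OF monoid_algebra_mono[OF M(4)]]
    by (auto simp: AN_restrict_apply ring_functor_closed[OF T] fun_eq_iff compose_def)
qed

section \<open>The transition map between attractors\<close>

text \<open>Being a morphism over T fixes the second component, so only the component in
  \<open>X\<close> carries information.\<close>

lemma attractorD:
  assumes "f \<in> attractor M X p a N T q" "cring R" "\<phi> \<in> Hom (ZZ M N) R" "t \<in> obj T R"
  obtains x where "f R (\<phi>, t) = (x, t)" "x \<in> obj X R" "p R x = q R t"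
proof -
  have f: "f \<in> mor (AN M N T) (pullback X T p q)"
    and pr: "mcomp (AN M N T) (proj2 (pullback X T p q)) f = proj2 (AN M N T)"
    using assms(1) by (simp_all add: attractor_def)
  have mem: "f R (\<phi>, t) \<in> obj (pullback X T p q) R"
    by (rule mor_closed[OF f]) (use assms in auto)
  then obtain x t' where xt: "f R (\<phi>, t) = (x, t')" "x \<in> obj X R" "t' \<in> obj T R" "p R x = q R t'"
    by (cases "f R (\<phi>, t)") auto
  have "proj2 (pullback X T p q) R (f R (\<phi>, t)) = proj2 (AN M N T) R (\<phi>, t)"
    using fun_cong[OF fun_cong[OF pr], of R "(\<phi>, t)"] assms by (simp add: mcomp_apply)
  then have "t' = t"
    using xt assms by (simp add: proj2_def)
  then show ?thesis using that xt by simp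
qed

lemma attractor_map_apply:
  "cring R \<Longrightarrow> \<phi> \<in> Hom (ZZ M N') R \<Longrightarrow> t \<in> obj T R \<Longrightarrow>
    attractor_map M N N' T f R (\<phi>, t) = f R (restrict \<phi> (carrier (ZZ M N)), t)"
  by (simp add: attractor_map_def mcomp_apply AN_restrict_apply)

lemma attractor_map_closed:
  fixes T :: "('u, 't) rfun"
  assumes M: "comm_monoid M" "submonoid N M" "submonoid N' M" "N \<subseteq> N'" and T: "ring_functor T"
    and f: "f \<in> attractor M X p a N T q"
  shows "attractor_map M N N' T f \<in> attractor M X p a N' T q"
  unfolding attractor_def
proof (intro CollectI conjI allI impI)
  have fm: "f \<in> mor (AN M N T) (pullback X T p q)"
    using f by (simp add: attractor_def)
  have res: "restrict \<phi> (carrier (ZZ M N)) \<in> Hom (ZZ M N) R"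
    if "cring R" "\<phi> \<in> Hom (ZZ M N') R" for R :: "'u ring" and \<phi>
    by (rule restrict_Hom[OF toric_ringI[OF that(1) M(1,2)] M(4) that(2)])
  show "attractor_map M N N' T f \<in> mor (AN M N' T) (pullback X T p q)"
    unfolding attractor_map_def
    by (intro mcomp_mor[OF _ AN_restrict_mor fm] ring_functor_AN M T)
  show "mcomp (AN M N' T) (proj2 (pullback X T p q)) (attractor_map M N N' T f) = proj2 (AN M N' T)"
  proof (intro ext)
    fix R z
    show "mcomp (AN M N' T) (proj2 (pullback X T p q)) (attractor_map M N N' T f) R z = proj2 (AN M N' T) R z"
    proof (cases "cring R \<and> z \<in> obj (AN M N' T) R")
      case True
      then obtain \<phi> t where z: "z = (\<phi>, t)" "\<phi> \<in> Hom (ZZ M N') R" "t \<in> obj T R" and R: "cring R"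
        by auto
      obtain x where "f R (restrict \<phi> (carrier (ZZ M N)), t) = (x, t)" "x \<in> obj X R" "p R x = q R t"
        using attractorD[OF f R res[OF R z(2)] z(3)] .
      then show ?thesis
        using z R by (simp add: mcomp_apply attractor_map_apply proj2_def)
    next
      case False
      \<comment> \<open>Outside the domain both sides are \<open>undefined\<close> by the
        normalization of morphisms.\<close>
      then show ?thesis by (auto simp: mcomp_def proj2_def compose_def)
    qed
  qed
  fix R g \<phi> t
  assume "cring R \<and> g \<in> Hom (ZZ M (carrier M)) R \<and> (\<phi>, t) \<in> obj (AN M N' T) R"
  then have *: "cring R" "g \<in> Hom (ZZ M (carrier M)) R" "\<phi> \<in> Hom (ZZ M N') R" "t \<in> obj T R"
    by auto
  note tor = toric_ringI[OF *(1) M(1)]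
  have "f R (toric_act M N R g (restrict \<phi> (carrier (ZZ M N))), t) =
      base_change_act q a R g (f R (restrict \<phi> (carrier (ZZ M N)), t))"
    using f * res[OF *(1,3)] by (simp add: attractor_def)
  then show "attractor_map M N N' T f R (toric_act M N' R g \<phi>, t) =
      base_change_act q a R g (attractor_map M N N' T f R (\<phi>, t))"
    using * by (simp add: attractor_map_apply toric_ring.toric_act_Hom[OF tor[OF M(3)]]
        restrict_toric_act[OF tor[OF M(2)] tor[OF M(3)] M(4)])
qed

text \<open>Restriction changes only the component \<open>\<phi>\<close> and base change only the
  component \<open>t\<close>, so the two operations commute.\<close>

lemma attractor_map_pullback:
  assumes M: "comm_monoid M" "submonoid N M" "N \<subseteq> N'" and u: "u \<in> mor T' T"
  shows "attractor_map M N N' T' (attractor_pullback M N T' u f) =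
    attractor_pullback M N' T' u (attractor_map M N N' T f)"
proof (intro ext)
  fix R z
  show "attractor_map M N N' T' (attractor_pullback M N T' u f) R z =
    attractor_pullback M N' T' u (attractor_map M N N' T f) R z"
  proof (cases "cring R \<and> z \<in> obj (AN M N' T') R")
    case True
    then obtain \<phi> t where z: "z = (\<phi>, t)" "\<phi> \<in> Hom (ZZ M N') R" "t \<in> obj T' R" and R: "cring R"
      by auto
    then show ?thesis
      using restrict_Hom[OF toric_ringI[OF R M(1,2)] M(3) z(2)] mor_closed[OF u R z(3)]
      by (simp add: attractor_map_apply attractor_pullback_def)
  next
    case False
    then show ?thesis
      by (auto simp: attractor_map_def mcomp_def attractor_pullback_def compose_def)
  qed
qed

text \<open>Naturality is used along both maps out of the universal ring: along \<open>h\<close>,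
  where the assumed agreement lives, and along \<open>ev\<close>, which brings the equality back to
  the given point.\<close>

lemma attractor_map_inj:
  fixes M :: "('u, 'e) monoid_scheme" and T :: "('u, 't) rfun"
  assumes inf: "infinite (UNIV :: 'u set)"
    and M: "comm_monoid M" "submonoid N M" "submonoid N' M" "N \<subseteq> N'"
    and X: "ring_functor X" "separated_over S X p" and T: "ring_functor T"
  shows "inj_on (attractor_map M N N' T) (attractor M X p a N T q)"
proof (rule inj_onI)
  fix f f'
  assume f: "f \<in> attractor M X p a N T q" and f': "f' \<in> attractor M X p a N T q"
    and eq: "attractor_map M N N' T f = attractor_map M N N' T f'"
  have fm: "f \<in> mor (AN M N T) (pullback X T p q)" and fm': "f' \<in> mor (AN M N T) (pullback X T p q)"
    using f f' by (simp_all add: attractor_def)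
  show "f = f'"
  proof (rule mor_eqI[OF fm fm'])
    fix R z assume R: "cring R" and "z \<in> obj (AN M N T) R"
    then obtain \<phi> t where z: "z = (\<phi>, t)" "\<phi> \<in> Hom (ZZ M N) R" "t \<in> obj T R"
      by auto
    obtain B C :: "'u ring" and i u u' h ev where BC: "cring B" "cring C"
      and i: "i \<in> Hom R B" and u: "u \<in> Hom (ZZ M N) B" and u': "u' \<in> Hom (ZZ M N') C"
      and h: "h \<in> Hom B C" "inj_on h (carrier B)" and ev: "ev \<in> Hom B R"
      and hu: "compose (carrier (ZZ M N)) h u = restrict u' (carrier (ZZ M N))"
      and evi: "compose (carrier R) ev i = (\<lambda>r\<in>carrier R. r)"
      and evu: "compose (carrier (ZZ M N)) ev u = \<phi>"
      using universal_point[OF inf R M z(2)] by metis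
    \<comment> \<open>The pair \<open>(u, s)\<close> is the universal point: \<open>u\<close> is the
      tautological character and \<open>s\<close> is \<open>t\<close> pulled back along R ->
      R[N].\<close>
    define s where "s = arr T R B i t"
    have s: "s \<in> obj T B"
      unfolding s_def by (rule ring_functor_closed[OF T R BC(1) i z(3)])
    have hs: "arr T B C h s \<in> obj T C"
      by (rule ring_functor_closed[OF T BC h(1) s])
    have us: "(u, s) \<in> obj (AN M N T) B" using u s by simp
    obtain x where x: "f B (u, s) = (x, s)" "x \<in> obj X B" "p B x = q B s"
      using attractorD[OF f BC(1) u s] .
    obtain x' where x': "f' B (u, s) = (x', s)" "x' \<in> obj X B" "p B x' = q B s"
      using attractorD[OF f' BC(1) u s] .
    \<comment> \<open>The image of the universal point under \<open>h\<close> does extend to Z[N'],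
      namely by \<open>u'\<close>, so the hypothesis on the restricted morphisms applies to
      it.\<close>
    have "f C (restrict u' (carrier (ZZ M N)), arr T B C h s) =
        f' C (restrict u' (carrier (ZZ M N)), arr T B C h s)"
      using eq attractor_map_apply[OF BC(2) u' hs] by metis
    then have "arr X B C h x = arr X B C h x'"
      using mor_natural[OF fm BC h(1) us] mor_natural[OF fm' BC h(1) us]
      by (simp add: hu x(1) x'(1))
    \<comment> \<open>Both lie over the image of \<open>s\<close> in \<open>S\<close>, which places
      the pair in the fibre product over \<open>S\<close>.\<close>
    moreover have "p B x = p B x'" by (simp only: x(3) x'(3))
    ultimately have "x = x'"
      by (intro separated_over_eqI[OF X(2,1) BC h x(2) x'(2)])
    then have same: "f B (u, s) = f' B (u, s)" by (simp only: x(1) x'(1))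
    have point: "arr (AN M N T) B R ev (u, s) = (\<phi>, t)"
      by (simp add: evu s_def ring_functor_comp[OF T R BC(1) R i ev z(3)] evi ring_functor_id[OF T R z(3)])
    show "f R z = f' R z"
      using mor_natural[OF fm BC(1) R ev us] mor_natural[OF fm' BC(1) R ev us]
      by (simp only: z(1) point same)
  qed
qed

lemma scheme_ring_functor: "is_scheme F \<Longrightarrow> ring_functor F"
  by (simp add: is_scheme_def zariski_sheaf_def)

text \<open>The first two conjuncts make the maps a morphism of functors. A morphism of set-valued
  functors that is injective on every T, as in the third, is a monomorphism.\<close>

theorem proposition3p28:
  fixes S :: "('u, 's) rfun" and X :: "('u, 'x) rfun"
    and p :: "'u ring \<Rightarrow> 'x \<Rightarrow> 's"
    and M :: "('u, 'e) monoid_scheme" and N N' :: "'u set"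
    and a :: "'u ring \<Rightarrow> ((('u \<Rightarrow> int) \<Rightarrow> 'u) \<times> 's) \<times> 'x \<Rightarrow> 'x"
  assumes "infinite (UNIV :: 'u set)"
    and "is_scheme S"
    and "comm_monoid M"
    and "algebraic_space_over TYPE('v) S X p"
    and "is_action M S X p a"
    and "separated_over S X p"
    and "submonoid N M" and "submonoid N' M" and "N \<subseteq> N'"
  shows
    "(\<forall>(T :: ('u, 't) rfun) q. is_scheme T \<and> q \<in> mor T S \<longrightarrow>
        attractor_map M N N' T \<in> attractor M X p a N T q \<rightarrow> attractor M X p a N' T q) \<and>
     (\<forall>(T :: ('u, 't) rfun) q (T' :: ('u, 't2) rfun) q' u.
        is_scheme T \<and> q \<in> mor T S \<and> is_scheme T' \<and> q' \<in> mor T' S \<and>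
        u \<in> mor T' T \<and> mcomp T' q u = q' \<longrightarrow>
        (\<forall>f \<in> attractor M X p a N T q.
           attractor_map M N N' T' (attractor_pullback M N T' u f) =
           attractor_pullback M N' T' u (attractor_map M N N' T f))) \<and>
     (\<forall>(T :: ('u, 't) rfun) q. is_scheme T \<and> q \<in> mor T S \<longrightarrow>
        inj_on (attractor_map M N N' T) (attractor M X p a N T q))"
proof -
  have "ring_functor X"
    using assms(4) by (simp add: algebraic_space_over_def etale_sheaf_def)
  then show ?thesis
    using assms
    by (intro conjI allI impI ballI funcsetI attractor_map_closed attractor_map_pullback attractor_map_inj)
      (auto intro: scheme_ring_functor)
qed

end
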